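(* Let $k\equiv 3\pmod 4$ and $n\ge 2$, and let $c\colon SG_{n,k}\to K_{k+2}$ be the canonical colouring. Then for every automorphism $\gamma$ of $SG_{n,k}$ there is a path in $\mathrm{Hom}(SG_{n,k},K_{k+2})$ from $c$ to $c\circ\gamma$.
   Context: Let $n\ge1$, $k\ge0$, $m=2n+k$. A subset $S\subseteq\{0,\dots,m-1\}$ is stable if $\{i,i+1\}\not\subseteq S$ for all $0\le i\le m-2$ and $\{0,m-1\}\not\subseteq S$. The stable Kneser graph $SG_{n,k}$ has as vertices the stable $n$-element subsets of $\{0,\dots,m-1\}$, two being adjacent iff they are disjoint. $K_{k+2}$ is the loopless complete graph on vertex set $\{0,\dots,k+1\}$. The canonical colouring is $c(S)=\min S$. For graphs $T,G$, $\mathrm{Hom}(T,G)$ is a cell complex whose vertices are the graph homomorphisms $T\to G$, two being joined by an edge if and only if they differ at exactly one vertex of $T$; a path is a path in this complex (equivalently a sequence of homomorphisms in which consecutive ones differ at exactly one vertex). *)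

theory Defs
  imports "HOL-Library.FuncSet"
begin

definition stable :: "nat \<Rightarrow> nat set \<Rightarrow> bool" where
  "stable m S \<longleftrightarrow> S \<subseteq> {0..<m}
     \<and> (\<forall>i. i + 1 < m \<longrightarrow> \<not> {i, i+1} \<subseteq> S)
     \<and> \<not> {0, m - 1} \<subseteq> S"

definition SG_verts :: "nat \<Rightarrow> nat \<Rightarrow> nat set set" where
  "SG_verts n k = {S. stable (2*n+k) S \<and> card S = n}"

definition SG_adj :: "nat set \<Rightarrow> nat set \<Rightarrow> bool" where
  "SG_adj S T \<longleftrightarrow> S \<inter> T = {}"

definition SG_hom :: "nat \<Rightarrow> nat \<Rightarrow> (nat set \<Rightarrow> nat) set" where
  "SG_hom n k = {f. f \<in> SG_verts n k \<rightarrow>\<^sub>E {0..k+1}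
     \<and> (\<forall>S\<in>SG_verts n k. \<forall>T\<in>SG_verts n k. SG_adj S T \<longrightarrow> f S \<noteq> f T)}"

definition SG_aut :: "nat \<Rightarrow> nat \<Rightarrow> (nat set \<Rightarrow> nat set) \<Rightarrow> bool" where
  "SG_aut n k \<gamma> \<longleftrightarrow> bij_betw \<gamma> (SG_verts n k) (SG_verts n k)
     \<and> (\<forall>S\<in>SG_verts n k. \<forall>T\<in>SG_verts n k. SG_adj S T \<longleftrightarrow> SG_adj (\<gamma> S) (\<gamma> T))"

definition canon_col :: "nat \<Rightarrow> nat \<Rightarrow> nat set \<Rightarrow> nat" where
  "canon_col n k = (\<lambda>S\<in>SG_verts n k. Min S)"

definition hom_edge :: "nat \<Rightarrow> nat \<Rightarrow> (nat set \<Rightarrow> nat) \<Rightarrow> (nat set \<Rightarrow> nat) \<Rightarrow> bool" where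
  "hom_edge n k f g \<longleftrightarrow> card {S \<in> SG_verts n k. f S \<noteq> g S} = 1"

definition hom_path :: "nat \<Rightarrow> nat \<Rightarrow> (nat set \<Rightarrow> nat) \<Rightarrow> (nat set \<Rightarrow> nat) \<Rightarrow> bool" where
  "hom_path n k f g \<longleftrightarrow> (\<exists>fs. fs \<noteq> [] \<and> hd fs = f \<and> last fs = g
     \<and> set fs \<subseteq> SG_hom n k
     \<and> (\<forall>i. i + 1 < length fs \<longrightarrow> hom_edge n k (fs ! i) (fs ! (i+1))))"

end

theory Submission
  imports Defs
begin

text \<open>
  \<^bold>\<open>Colours.\<close>  Recolouring the sets that contain the last point gives a path from the canonical
  colouring \<open>c\<close> to \<open>\<tau> \<circ> c \<circ> rotation\<close> with \<open>\<tau>\<close> a \<open>(k+2)\<close>-cycle of the colours; choosing the greatest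
  instead of the least element of \<open>S \<inter> {0..k+1}\<close> gives a path to \<open>\<rho> \<circ> c \<circ> reflection\<close> with \<open>\<rho>\<close> the
  reversal of the colours.  For \<open>k \<equiv> 3 (mod 4)\<close> both \<open>\<tau>\<close> and \<open>\<rho>\<close> are even, so it suffices to connect
  \<open>c\<close> to \<open>\<pi> \<circ> c\<close> for 3-cycles \<open>\<pi>\<close> of consecutive colours.  As \<open>S \<mapsto> S - {Max S}\<close> is a
  homomorphism compatible with \<open>c\<close>, this reduces to \<open>n = 2\<close>, where a 5-cycle of pairs can be
  recoloured by hand; conjugating with \<open>\<tau>\<close> yields the other consecutive 3-cycles.

  \<^bold>\<open>Automorphisms.\<close>  Every automorphism is induced by a rotation or a reflection.  Two vertices differ
  by moving one element by one step around the cycle if and only if no third vertex is adjacent to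
  all their common neighbours, so automorphisms preserve such moves.  A square of moves has the same
  cycle edge on opposite sides, and all moves along one cycle edge are linked by squares, so an
  automorphism permutes the edges of the \<open>m\<close>-cycle.  Two edges are at distance at most 2 if and only if
  some pair of moves along them fails to span a square; hence the permutation of edges is dihedral.
  An automorphism fixing all edges is the identity.
\<close>

section \<open>Paths of homomorphisms\<close>

definition hom_step :: "nat \<Rightarrow> nat \<Rightarrow> (nat set \<Rightarrow> nat) \<Rightarrow> (nat set \<Rightarrow> nat) \<Rightarrow> bool" where
  "hom_step n k f g \<longleftrightarrow> f \<in> SG_hom n k \<and> g \<in> SG_hom n k \<and> hom_edge n k f g"

text \<open>The empty walk says nothing about \<open>f\<close>, so \<open>f \<in> SG_hom n k\<close>
  is demanded separately.\<close>

definition hom_conn :: "nat \<Rightarrow> nat \<Rightarrow> (nat set \<Rightarrow> nat) \<Rightarrow> (nat set \<Rightarrow> nat) \<Rightarrow> bool" where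
  "hom_conn n k f g \<longleftrightarrow> f \<in> SG_hom n k \<and> (hom_step n k)\<^sup>*\<^sup>* f g"

lemma finite_SG_verts [simp]: "finite (SG_verts n k)"
  by (rule finite_subset[of _ "Pow {0..<2*n+k}"]) (auto simp: SG_verts_def stable_def)

lemma SG_homD:
  assumes "f \<in> SG_hom n k" "S \<in> SG_verts n k"
  shows "f S \<le> k + 1"
    and "T \<in> SG_verts n k \<Longrightarrow> SG_adj S T \<Longrightarrow> f S \<noteq> f T"
  using assms unfolding SG_hom_def by auto

lemma hom_step_sym: "hom_step n k f g \<Longrightarrow> hom_step n k g f"
proof -
  have "{S \<in> SG_verts n k. f S \<noteq> g S} = {S \<in> SG_verts n k. g S \<noteq> f S}"
    by auto
  then show "hom_step n k f g \<Longrightarrow> hom_step n k g f"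
    by (simp add: hom_step_def hom_edge_def)
qed

lemma hom_conn_hom:
  assumes "hom_conn n k f g"
  shows "f \<in> SG_hom n k" "g \<in> SG_hom n k"
proof -
  show "f \<in> SG_hom n k" using assms by (simp add: hom_conn_def)
  have "(hom_step n k)\<^sup>*\<^sup>* f g" using assms by (simp add: hom_conn_def)
  then show "g \<in> SG_hom n k"
    using \<open>f \<in> SG_hom n k\<close> by (induction) (auto simp: hom_step_def)
qed

lemma hom_conn_refl: "f \<in> SG_hom n k \<Longrightarrow> hom_conn n k f f"
  by (simp add: hom_conn_def)

lemma hom_conn_trans [trans]:
  "hom_conn n k f g \<Longrightarrow> hom_conn n k g h \<Longrightarrow> hom_conn n k f h"
  by (auto simp: hom_conn_def)

lemma hom_conn_sym: "hom_conn n k f g \<Longrightarrow> hom_conn n k g f"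
proof -
  assume a: "hom_conn n k f g"
  have "symp ((hom_step n k)\<^sup>*\<^sup>*)"
    by (metis symp_rtranclp sympI hom_step_sym)
  then show ?thesis
    using a hom_conn_hom[OF a] by (auto simp: hom_conn_def dest: sympD)
qed

lemma hom_conn_imp_hom_path:
  assumes "hom_conn n k f g"
  shows "hom_path n k f g"
proof -
  have "(hom_step n k)\<^sup>*\<^sup>* f g" using assms by (simp add: hom_conn_def)
  then show ?thesis
  proof (induction)
    case base
    show ?case unfolding hom_path_def
      by (rule exI[of _ "[f]"]) (use hom_conn_hom[OF assms] in auto)
  next
    case (step g h)
    from step.IH obtain fs where fs: "fs \<noteq> []" "hd fs = f" "last fs = g"
      "set fs \<subseteq> SG_hom n k"
      "\<And>i. i + 1 < length fs \<Longrightarrow> hom_edge n k (fs ! i) (fs ! (i+1))"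
      unfolding hom_path_def by auto
    have gh: "hom_edge n k g h" "h \<in> SG_hom n k"
      using step.hyps(2) by (auto simp: hom_step_def)
    have "hom_edge n k ((fs @ [h]) ! i) ((fs @ [h]) ! (i+1))"
      if i: "i + 1 < length (fs @ [h])" for i
    proof (cases "i + 1 < length fs")
      case True
      then show ?thesis using fs(5)[OF True] by (simp add: nth_append)
    next
      case False
      then have "i = length fs - 1" "i + 1 = length fs" using i fs(1) by auto
      then show ?thesis
        using gh fs(1,3) by (simp add: nth_append last_conv_nth)
    qed
    then show ?case unfolding hom_path_def
      by (intro exI[of _ "fs @ [h]"]) (use fs gh in auto)
  qed
qed

lemma SG_hom_ext:
  assumes "f \<in> SG_hom n k" "g \<in> SG_hom n k" "\<And>S. S \<in> SG_verts n k \<Longrightarrow> f S = g S"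
  shows "f = g"
proof (rule PiE_ext)
  show "f \<in> SG_verts n k \<rightarrow>\<^sub>E {0..k+1}" "g \<in> SG_verts n k \<rightarrow>\<^sub>E {0..k+1}"
    using assms(1,2) by (simp_all add: SG_hom_def)
qed (rule assms(3))

text \<open>Under the last hypothesis every mixture of the two colourings is again a homomorphism.\<close>

lemma hom_conn_mix:
  assumes "f \<in> SG_hom n k" "g \<in> SG_hom n k"
    and "\<And>S T. S \<in> SG_verts n k \<Longrightarrow> T \<in> SG_verts n k \<Longrightarrow> SG_adj S T \<Longrightarrow> f S \<noteq> g T"
  shows "hom_conn n k f g"
  using assms
proof (induction "card {S \<in> SG_verts n k. f S \<noteq> g S}" arbitrary: f rule: less_induct)
  case less
  show ?case
  proof (cases "\<forall>S\<in>SG_verts n k. f S = g S")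
    case True
    then show ?thesis
      using SG_hom_ext[OF less.prems(1,2)] hom_conn_refl less.prems(1) by blast
  next
    case False
    then obtain v where v: "v \<in> SG_verts n k" "f v \<noteq> g v" by blast
    let ?f = "f(v := g v)"
    have sym: "SG_adj S T \<longleftrightarrow> SG_adj T S" for S T by (auto simp: SG_adj_def)
    have D: "f S \<noteq> f T" "g S \<noteq> g T" "f S \<noteq> g T"
      if "S \<in> SG_verts n k" "T \<in> SG_verts n k" "SG_adj S T" for S T
      using that less.prems SG_homD(2) by blast+
    have gv: "g v \<le> k + 1" using SG_homD(1) less.prems(2) v by blast
    have f: "?f \<in> SG_hom n k"
      unfolding SG_hom_def
    proof (intro CollectI conjI ballI impI)
      show "?f \<in> SG_verts n k \<rightarrow>\<^sub>E {0..k + 1}"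
        using less.prems(1) gv v(1) unfolding SG_hom_def by (auto simp: PiE_iff extensional_def)
    next
      fix S T assume st: "S \<in> SG_verts n k" "T \<in> SG_verts n k" "SG_adj S T"
      then show "?f S \<noteq> ?f T" using D[OF st] D[OF st(2,1)] sym by auto
    qed
    have e: "{S \<in> SG_verts n k. f S \<noteq> ?f S} = {v}" using v by auto
    then have step: "hom_step n k f ?f"
      using less.prems(1) f by (simp add: hom_step_def hom_edge_def)
    have "{S \<in> SG_verts n k. ?f S \<noteq> g S} = {S \<in> SG_verts n k. f S \<noteq> g S} - {v}"
      by auto
    then have lt: "card {S \<in> SG_verts n k. ?f S \<noteq> g S} < card {S \<in> SG_verts n k. f S \<noteq> g S}"
      using v by (intro psubset_card_mono) auto
    have mix: "?f S \<noteq> g T" if "S \<in> SG_verts n k" "T \<in> SG_verts n k" "SG_adj S T" for S T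
      using D(2,3)[OF that] by (cases "S = v") simp_all
    have "hom_conn n k ?f g" by (rule less.hyps[OF lt f less.prems(2) mix])
    then show ?thesis using step less.prems(1)
      unfolding hom_conn_def by (meson converse_rtranclp_into_rtranclp)
  qed
qed

lemma SG_hom_precomp:
  assumes "f \<in> SG_hom n k" "\<And>S. S \<in> SG_verts n' k \<Longrightarrow> p S \<in> SG_verts n k"
    and "\<And>S T. S \<in> SG_verts n' k \<Longrightarrow> T \<in> SG_verts n' k \<Longrightarrow> SG_adj S T \<Longrightarrow> SG_adj (p S) (p T)"
  shows "(\<lambda>S\<in>SG_verts n' k. f (p S)) \<in> SG_hom n' k"
  using assms unfolding SG_hom_def by (auto simp: PiE_iff)

text \<open>Several sets may have the same image under \<open>p\<close>, so an edge need not pull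
  back to an edge. But when \<open>p S\<close> and \<open>p T\<close> are adjacent, at most one of
  them is the recoloured vertex, so \<open>hom_conn_mix\<close> joins the two pullbacks.\<close>

lemma hom_conn_precomp:
  assumes "hom_conn n k f g" and p: "\<And>S. S \<in> SG_verts n' k \<Longrightarrow> p S \<in> SG_verts n k"
    "\<And>S T. S \<in> SG_verts n' k \<Longrightarrow> T \<in> SG_verts n' k \<Longrightarrow> SG_adj S T \<Longrightarrow> SG_adj (p S) (p T)"
  shows "hom_conn n' k (\<lambda>S\<in>SG_verts n' k. f (p S)) (\<lambda>S\<in>SG_verts n' k. g (p S))"
proof -
  have pre: "(\<lambda>S\<in>SG_verts n' k. h (p S)) \<in> SG_hom n' k" if "h \<in> SG_hom n k" for h
    by (rule SG_hom_precomp[OF that]) (rule p; assumption)+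
  have "(hom_step n k)\<^sup>*\<^sup>* f g" "f \<in> SG_hom n k" using assms(1) by (auto simp: hom_conn_def)
  then show ?thesis
  proof (induction)
    case base
    then show ?case by (intro hom_conn_refl pre)
  next
    case (step g h)
    have gh: "g \<in> SG_hom n k" "h \<in> SG_hom n k" "hom_edge n k g h"
      using step.hyps(2) by (auto simp: hom_step_def)
    then obtain v where v: "{S \<in> SG_verts n k. g S \<noteq> h S} = {v}"
      unfolding hom_edge_def using card_1_singletonE by blast
    have "g S \<noteq> h T" if "S \<in> SG_verts n k" "T \<in> SG_verts n k" "SG_adj S T" for S T
    proof (cases "S = v")
      case True
      then have "T \<noteq> v" using SG_homD(2)[OF gh(1) that] by auto
      then have "g T = h T" using v that(2) by auto
      then show ?thesis using SG_homD(2)[OF gh(1) that] by simp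
    next
      case False
      then have "g S = h S" using v that(1) by auto
      then show ?thesis using SG_homD(2)[OF gh(2) that] by simp
    qed
    then have "hom_conn n' k (\<lambda>S\<in>SG_verts n' k. g (p S)) (\<lambda>S\<in>SG_verts n' k. h (p S))"
      by (intro hom_conn_mix pre gh) (simp_all add: p)
    then show ?case using step hom_conn_trans by blast
  qed
qed

lemma SG_hom_postcomp:
  assumes "f \<in> SG_hom n k" "inj_on \<pi> {0..k+1}" "\<pi> ` {0..k+1} \<subseteq> {0..k+1}"
  shows "(\<lambda>S\<in>SG_verts n k. \<pi> (f S)) \<in> SG_hom n k"
  unfolding SG_hom_def
proof (intro CollectI conjI ballI impI)
  have "f S \<in> {0..k+1}" if "S \<in> SG_verts n k" for S
    using SG_homD(1)[OF assms(1) that] by simp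
  then show "(\<lambda>S\<in>SG_verts n k. \<pi> (f S)) \<in> SG_verts n k \<rightarrow>\<^sub>E {0..k + 1}"
    using assms(3) by (auto simp del: atLeastAtMost_iff)
next
  fix S T assume "S \<in> SG_verts n k" "T \<in> SG_verts n k" "SG_adj S T"
  then show "(\<lambda>S\<in>SG_verts n k. \<pi> (f S)) S \<noteq> (\<lambda>S\<in>SG_verts n k. \<pi> (f S)) T"
    using SG_homD[OF assms(1)] by (auto dest!: inj_onD[OF assms(2)])
qed

text \<open>An injective \<open>\<pi>\<close> leaves the set of disagreements unchanged, so edges go
  to edges.\<close>

lemma hom_conn_postcomp:
  assumes "hom_conn n k f g" and p: "inj_on \<pi> {0..k+1}" "\<pi> ` {0..k+1} \<subseteq> {0..k+1}"
  shows "hom_conn n k (\<lambda>S\<in>SG_verts n k. \<pi> (f S)) (\<lambda>S\<in>SG_verts n k. \<pi> (g S))"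
proof -
  have "(hom_step n k)\<^sup>*\<^sup>* f g" "f \<in> SG_hom n k" using assms(1) by (auto simp: hom_conn_def)
  then show ?thesis
  proof (induction)
    case base
    then show ?case by (intro hom_conn_refl SG_hom_postcomp p)
  next
    case (step g h)
    have gh: "g \<in> SG_hom n k" "h \<in> SG_hom n k" "hom_edge n k g h"
      using step.hyps(2) by (auto simp: hom_step_def)
    have "{S \<in> SG_verts n k. (\<lambda>S\<in>SG_verts n k. \<pi> (g S)) S \<noteq> (\<lambda>S\<in>SG_verts n k. \<pi> (h S)) S}
        = {S \<in> SG_verts n k. g S \<noteq> h S}"
      using SG_homD(1)[OF gh(1)] SG_homD(1)[OF gh(2)] by (auto dest!: inj_onD[OF p(1)])
    then have "hom_step n k (\<lambda>S\<in>SG_verts n k. \<pi> (g S)) (\<lambda>S\<in>SG_verts n k. \<pi> (h S))"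
      using gh SG_hom_postcomp p by (simp add: hom_step_def hom_edge_def)
    then show ?case using step unfolding hom_conn_def
      by (meson rtranclp.rtrancl_into_rtrancl)
  qed
qed

section \<open>Stable sets and the range of their minima\<close>

lemma SG_vertsD:
  assumes "S \<in> SG_verts n k"
  shows "S \<subseteq> {0..<2*n+k}" "card S = n" "finite S" "n \<ge> 1 \<Longrightarrow> S \<noteq> {}"
  using assms by (auto simp: SG_verts_def stable_def intro: finite_subset)

lemma SG_verts_Suc:
  assumes "S \<in> SG_verts n k" "x \<in> S"
  shows "Suc x \<notin> S"
proof
  assume "Suc x \<in> S"
  then have "x + 1 < 2*n+k" "{x, x+1} \<subseteq> S" using assms SG_vertsD(1)[OF assms(1)] by auto
  then show False using assms(1) by (auto simp: SG_verts_def stable_def)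
qed

text \<open>\<open>S\<close> and its shift by one are disjoint, equally large subsets of
  \<open>{a..b}\<close>.\<close>

lemma card_no_consecutive:
  assumes "S \<subseteq> {a..<b}" "\<And>x. x \<in> S \<Longrightarrow> Suc x \<notin> S"
  shows "2 * card S \<le> Suc b - a"
proof -
  have fin: "finite S" using assms(1) finite_subset by blast
  have "card (S \<union> Suc ` S) = card S + card (Suc ` S)"
    by (rule card_Un_disjoint) (use fin assms(2) in auto)
  also have "\<dots> = 2 * card S" by (simp add: card_image)
  finally have "2 * card S = card (S \<union> Suc ` S)" by simp
  also have "\<dots> \<le> card {a..b}"
    by (rule card_mono) (use assms(1) in auto)
  finally show ?thesis by simp
qed

text \<open>The count is applied in an interval starting at \<open>Min S\<close>. If
  \<open>S\<close> misses the last point, the interval is shorter by one, so colour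
  \<open>k + 1\<close> occurs only on sets containing the last point.\<close>

lemma Min_SG_verts:
  assumes "S \<in> SG_verts n k" "n \<ge> 1"
  shows "Min S \<in> S" "Min S \<le> k + 1" "2*n+k-1 \<notin> S \<Longrightarrow> Min S \<le> k"
proof -
  note S = SG_vertsD[OF assms(1)]
  show "Min S \<in> S" using S assms(2) by auto
  have "S \<subseteq> {Min S..<2*n+k}" using S(1,3) by auto
  from card_no_consecutive[OF this SG_verts_Suc[OF assms(1)]] S(2)
  show "Min S \<le> k + 1" using assms(2) by linarith
  show "Min S \<le> k" if "2*n+k-1 \<notin> S"
  proof -
    have "x < 2*n+k-1" if "x \<in> S" for x
    proof -
      have "x < 2*n+k" "x \<noteq> 2*n+k-1" using S(1) that \<open>2*n+k-1 \<notin> S\<close> by auto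
      then show ?thesis by linarith
    qed
    then have "S \<subseteq> {Min S..<2*n+k-1}" using S(3) by auto
    from card_no_consecutive[OF this SG_verts_Suc[OF assms(1)]] S(2)
    show ?thesis using assms(2) by linarith
  qed
qed

lemma canon_col_hom:
  assumes "n \<ge> 1"
  shows "canon_col n k \<in> SG_hom n k"
proof -
  have "Min S \<noteq> Min T" if "S \<in> SG_verts n k" "T \<in> SG_verts n k" "SG_adj S T" for S T
    using Min_SG_verts(1)[OF that(1) assms] Min_SG_verts(1)[OF that(2) assms] that(3)
    by (auto simp: SG_adj_def)
  then show ?thesis
    using Min_SG_verts(2)[OF _ assms] by (auto simp: SG_hom_def canon_col_def)
qed

section \<open>A cyclic permutation of three colours\<close>

lemma SG_verts_2_cases:
  assumes "S \<in> SG_verts 2 k"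
  obtains i j where "S = {i, j}" "Min S = i" "Max S = j" "i + 2 \<le> j" "j < k + 4"
proof -
  note result = that
  obtain x y where xy: "S = {x, y}" "x \<noteq> y"
    using SG_vertsD(2)[OF assms] by (auto simp: card_2_iff)
  have *: thesis if "S = {i, j}" "i < j" for i j
  proof (rule result)
    have "j \<noteq> Suc i" using SG_verts_Suc[OF assms, of i] that by auto
    then show "i + 2 \<le> j" using that by simp
    show "j < k + 4" using SG_vertsD(1)[OF assms] that by auto
  qed (use that in auto)
  show thesis using *[of x y] *[of y x] xy by (metis insert_commute linorder_neqE_nat)
qed

text \<open>
  Colourings of the pairs which agree with the minimum below \<open>e\<close> and are given by a table on the
  six pairs of non-consecutive elements of \<open>{e..e+4}\<close>.
\<close>

definition table :: "nat \<Rightarrow> nat \<Rightarrow> nat \<Rightarrow> nat \<Rightarrow> nat \<Rightarrow> nat \<Rightarrow> nat \<Rightarrow> nat \<Rightarrow> nat" where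
  "table c02 c03 c04 c13 c14 c24 i j =
    (if i = 0 then if j = 2 then c02 else if j = 3 then c03 else c04
     else if i = 1 then if j = 3 then c13 else c14 else c24)"

definition table_col :: "nat \<Rightarrow> (nat \<Rightarrow> nat \<Rightarrow> nat) \<Rightarrow> nat set \<Rightarrow> nat" where
  "table_col e q = (\<lambda>S\<in>SG_verts 2 (Suc e).
     if Min S < e then Min S else e + q (Min S - e) (Max S - e))"

text \<open>The inequalities run over the ordered pairs of disjoint table entries. With
  \<open>r = q\<close> they make the table a proper colouring; in general they are the hypothesis of
  \<open>hom_conn_mix\<close>.\<close>

definition table_ok :: "(nat \<Rightarrow> nat \<Rightarrow> nat) \<Rightarrow> (nat \<Rightarrow> nat \<Rightarrow> nat) \<Rightarrow> bool" where
  "table_ok q r \<longleftrightarrow> (\<forall>j\<in>{2,3,4}. q 0 j \<le> 2) \<and> (\<forall>j\<in>{3,4}. q 1 j \<le> 2) \<and> q 2 4 \<le> 2 \<and>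
     q 0 2 \<noteq> r 1 3 \<and> q 0 2 \<noteq> r 1 4 \<and> q 1 3 \<noteq> r 2 4 \<and> q 0 3 \<noteq> r 2 4 \<and> q 0 3 \<noteq> r 1 4 \<and>
     q 0 4 \<noteq> r 1 3 \<and> q 1 3 \<noteq> r 0 2 \<and> q 1 4 \<noteq> r 0 2 \<and> q 2 4 \<noteq> r 1 3 \<and> q 2 4 \<noteq> r 0 3 \<and>
     q 1 4 \<noteq> r 0 3 \<and> q 1 3 \<noteq> r 0 4"

lemma pair_in_5_cases:
  fixes i j e :: nat
  assumes "i + 2 \<le> j" "j < e + 5" "e \<le> i"
  shows "(i, j) \<in> {(e, e+2), (e, e+3), (e, e+4), (e+1, e+3), (e+1, e+4), (e+2, e+4)}"
proof -
  obtain a where a: "i = e + a" using assms(3) le_Suc_ex by blast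
  obtain b where b: "j = e + a + 2 + b" using assms(1) a le_Suc_ex by (metis add.assoc)
  have "a + b < 3" using assms(2) a b by simp
  then have "(a, b) \<in> {(0,0),(0,1),(0,2),(1,0),(1,1),(2,0)}" by auto
  then show ?thesis using a b by auto
qed

text \<open>Pairs starting below \<open>e\<close> have colours below \<open>e\<close> and table
  colours are at least \<open>e\<close>, so a conflict could only arise between two minima, which
  differ by disjointness, or inside the table.\<close>

lemma table_col_adj:
  assumes "table_ok q r" "S \<in> SG_verts 2 (Suc e)" "T \<in> SG_verts 2 (Suc e)" "SG_adj S T"
  shows "table_col e q S \<noteq> table_col e r T"
proof -
  obtain i j where S: "S = {i, j}" "Min S = i" "Max S = j" "i + 2 \<le> j" "j < Suc e + 4"
    using SG_verts_2_cases[OF assms(2)] .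
  obtain i' j' where T: "T = {i', j'}" "Min T = i'" "Max T = j'" "i' + 2 \<le> j'" "j' < Suc e + 4"
    using SG_verts_2_cases[OF assms(3)] .
  have d: "i \<noteq> i'" "i \<noteq> j'" "j \<noteq> i'" "j \<noteq> j'" using assms(4) S(1) T(1) by (auto simp: SG_adj_def)
  show ?thesis
  proof (cases "i < e \<or> i' < e")
    case True
    then show ?thesis using assms(2,3) d S(2) T(2) by (auto simp: table_col_def)
  next
    case False
    have "(i, j) \<in> {(e, e+2), (e, e+3), (e, e+4), (e+1, e+3), (e+1, e+4), (e+2, e+4)}"
      by (rule pair_in_5_cases) (use S False in auto)
    moreover have "(i', j') \<in> {(e, e+2), (e, e+3), (e, e+4), (e+1, e+3), (e+1, e+4), (e+2, e+4)}"
      by (rule pair_in_5_cases) (use T False in auto)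
    moreover have "table_col e q S = e + q (i - e) (j - e)" "table_col e r T = e + r (i' - e) (j' - e)"
      using assms(2,3) S(2,3) T(2,3) False by (auto simp: table_col_def)
    ultimately show ?thesis
      using d assms(1) unfolding table_ok_def by (elim insertE emptyE) simp_all
  qed
qed

lemma table_col_hom:
  assumes "table_ok q q"
  shows "table_col e q \<in> SG_hom 2 (Suc e)"
proof -
  have "table_col e q S \<le> Suc e + 1" if S': "S \<in> SG_verts 2 (Suc e)" for S
  proof -
    obtain i j where S: "S = {i, j}" "Min S = i" "Max S = j" "i + 2 \<le> j" "j < Suc e + 4"
      using SG_verts_2_cases[OF S'] .
    show ?thesis
    proof (cases "i < e")
      case True
      then show ?thesis using S S' by (simp add: table_col_def)
    next
      case False
      have "(i, j) \<in> {(e, e+2), (e, e+3), (e, e+4), (e+1, e+3), (e+1, e+4), (e+2, e+4)}"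
        by (rule pair_in_5_cases) (use S False in auto)
      moreover have "table_col e q S = e + q (i - e) (j - e)"
        using S' S(2,3) False by (auto simp: table_col_def)
      ultimately show ?thesis
        using assms unfolding table_ok_def by (elim insertE emptyE) simp_all
    qed
  qed
  then show ?thesis
    using table_col_adj[OF assms] by (auto simp: SG_hom_def) (auto simp: table_col_def)
qed

lemma table_col_conn:
  assumes "table_ok q q" "table_ok r r" "table_ok q r"
  shows "hom_conn 2 (Suc e) (table_col e q) (table_col e r)"
  by (rule hom_conn_mix) (use assms table_col_hom table_col_adj in auto)

text \<open>Adjacent transpositions generate all permutations of the colours, and the length of a
  word in them determines its parity.\<close>

definition swp :: "nat \<Rightarrow> nat \<Rightarrow> nat" where
  "swp i j = (if j = i then i + 1 else if j = i + 1 then i else j)"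

text \<open>
  The five pairs other than \<open>{e, e+4}\<close> induce a 5-cycle, and a 3-colouring of a 5-cycle has a
  single increment of the opposite sign.  Moving it once around the cycle permutes the colours
  cyclically.
\<close>

lemma canon_col_2_three_cycle:
  "hom_conn 2 (Suc e) (canon_col 2 (Suc e))
     (\<lambda>S\<in>SG_verts 2 (Suc e). swp (Suc e) (swp e (canon_col 2 (Suc e) S)))"
proof -
  let ?c = "\<lambda>a b c d f g. table_col e (table a b c d f g)"
  have rows: "(Min S, Max S) \<in> {(e, e+2), (e, e+3), (e, e+4), (e+1, e+3), (e+1, e+4), (e+2, e+4)}"
    if S: "S \<in> SG_verts 2 (Suc e)" "\<not> Min S < e" for S
  proof -
    obtain i j where "S = {i, j}" "Min S = i" "Max S = j" "i + 2 \<le> j" "j < Suc e + 4"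
      using SG_verts_2_cases[OF S(1)] .
    then show ?thesis using S(2) by (intro pair_in_5_cases) auto
  qed
  have "canon_col 2 (Suc e) S = ?c 0 0 0 1 1 2 S" for S
    using rows[of S] by (cases "S \<in> SG_verts 2 (Suc e)"; cases "Min S < e")
      (auto simp: canon_col_def table_col_def table_def)
  then have 1: "canon_col 2 (Suc e) = ?c 0 0 0 1 1 2" by blast
  have "(\<lambda>S\<in>SG_verts 2 (Suc e). swp (Suc e) (swp e (canon_col 2 (Suc e) S))) S = ?c 2 2 2 0 0 1 S" for S
    using rows[of S] by (cases "S \<in> SG_verts 2 (Suc e)"; cases "Min S < e")
      (auto simp: canon_col_def table_col_def table_def swp_def)
  then have 2: "(\<lambda>S\<in>SG_verts 2 (Suc e). swp (Suc e) (swp e (canon_col 2 (Suc e) S))) = ?c 2 2 2 0 0 1"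
    by blast
  \<comment> \<open>Each step recolours one pair of the 5-cycle. The pair \<open>{e, e+4}\<close>,
    whose only neighbour in the table is \<open>{e+1, e+3}\<close>, changes along with
    \<open>{e, e+2}\<close> in the first step.\<close>
  have "hom_conn 2 (Suc e) (?c 0 0 0 1 1 2) (?c 2 0 2 1 1 2)"
    by (rule table_col_conn) (simp_all add: table_ok_def table_def)
  also have "hom_conn 2 (Suc e) (?c 2 0 2 1 1 2) (?c 2 0 2 0 1 2)"
    by (rule table_col_conn) (simp_all add: table_ok_def table_def)
  also have "hom_conn 2 (Suc e) (?c 2 0 2 0 1 2) (?c 2 0 2 0 1 1)"
    by (rule table_col_conn) (simp_all add: table_ok_def table_def)
  also have "hom_conn 2 (Suc e) (?c 2 0 2 0 1 1) (?c 2 2 2 0 1 1)"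
    by (rule table_col_conn) (simp_all add: table_ok_def table_def)
  also have "hom_conn 2 (Suc e) (?c 2 2 2 0 1 1) (?c 2 2 2 0 0 1)"
    by (rule table_col_conn) (simp_all add: table_ok_def table_def)
  finally show ?thesis using 1 2 by simp
qed

text \<open>All other elements are at least two below the maximum, so they fit into a cycle shorter
  by two. If they contained both ends of it, the maximum would be the last point of the long cycle,
  next to \<open>0\<close>.\<close>

lemma SG_verts_remove_Max:
  assumes "S \<in> SG_verts (Suc n) k" "n \<ge> 1"
  shows "S - {Max S} \<in> SG_verts n k"
    and "Min (S - {Max S}) = Min S"
proof -
  note S = SG_vertsD[OF assms(1)]
  have ne: "S \<noteq> {}" using S(4) by simp
  have mx: "Max S \<in> S" using S(3) ne by simp
  have card: "card (S - {Max S}) = n" using S(2,3) mx by simp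
  then have ne': "S - {Max S} \<noteq> {}" using assms(2) by (metis card.empty not_one_le_zero)
  have lt: "x < Max S" if "x \<in> S - {Max S}" for x
    using that S(3) by (metis Diff_iff Max_ge insertI1 nless_le)
  have lt2: "Suc x < Max S" if "x \<in> S - {Max S}" for x
    using lt[OF that] SG_verts_Suc[OF assms(1)] that mx by (metis Diff_iff Suc_lessI)
  have bd: "Max S < 2 * Suc n + k" using S(1) mx by auto
  have cyc: "\<not> {0, 2*n+k-1} \<subseteq> S - {Max S}"
  proof
    assume a: "{0, 2*n+k-1} \<subseteq> S - {Max S}"
    then have "Suc (2*n+k-1) < Max S" using lt2 by blast
    then have "Max S = 2 * Suc n + k - 1" using bd assms(2) by arith
    then have "{0, 2 * Suc n + k - 1} \<subseteq> S" using a mx by auto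
    then show False using assms(1) by (auto simp: SG_verts_def stable_def)
  qed
  have "S - {Max S} \<subseteq> {0..<2*n+k}" using lt2 bd by fastforce
  then show "S - {Max S} \<in> SG_verts n k"
    using card cyc SG_verts_Suc[OF assms(1)] by (auto simp: SG_verts_def stable_def)
  have "Min S \<noteq> Max S"
  proof
    assume eq: "Min S = Max S"
    obtain x where "x \<in> S - {Max S}" using ne' by blast
    then show False using lt[of x] Min_le[OF S(3), of x] eq by auto
  qed
  then have "Min S \<in> S - {Max S}" using S(3) ne by simp
  then show "Min (S - {Max S}) = Min S"
    using S(3) by (intro Min_eqI) auto
qed

lemma canon_col_three_cycle:
  assumes "n \<ge> 2" "k \<ge> 1"
  shows "hom_conn n k (canon_col n k)
     (\<lambda>S\<in>SG_verts n k. swp k (swp (k-1) (canon_col n k S)))"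
  using assms(1)
proof (induction n rule: dec_induct)
  case base
  have "Suc (k - 1) = k" using assms(2) by simp
  then show ?case using canon_col_2_three_cycle[of "k-1"] by (simp only:)
next
  case (step n)
  let ?p = "\<lambda>S. S - {Max S}"
  have p: "?p S \<in> SG_verts n k" if "S \<in> SG_verts (Suc n) k" for S
    using SG_verts_remove_Max(1)[OF that] step.hyps by simp
  have c: "canon_col n k (?p S) = canon_col (Suc n) k S" if "S \<in> SG_verts (Suc n) k" for S
    using SG_verts_remove_Max(2)[OF that] p[OF that] that step.hyps by (simp add: canon_col_def)
  have "hom_conn (Suc n) k (\<lambda>S\<in>SG_verts (Suc n) k. canon_col n k (?p S))
     (\<lambda>S\<in>SG_verts (Suc n) k. (\<lambda>S\<in>SG_verts n k. swp k (swp (k-1) (canon_col n k S))) (?p S))"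
    by (rule hom_conn_precomp[OF step.IH p]) (auto simp: SG_adj_def)
  moreover have "(\<lambda>S\<in>SG_verts (Suc n) k. canon_col n k (?p S)) = canon_col (Suc n) k"
    using c by (auto simp: canon_col_def)
  moreover have "(\<lambda>S\<in>SG_verts (Suc n) k. (\<lambda>S\<in>SG_verts n k. swp k (swp (k-1) (canon_col n k S))) (?p S))
     = (\<lambda>S\<in>SG_verts (Suc n) k. swp k (swp (k-1) (canon_col (Suc n) k S)))"
    using c p by (intro restrict_ext) simp
  ultimately show ?case by (simp only:)
qed

section \<open>Even permutations of the colours, rotations and reflections\<close>

fun swps :: "nat list \<Rightarrow> nat \<Rightarrow> nat" where
  "swps [] j = j"
| "swps (i # l) j = swp i (swps l j)"

lemma swps_append: "swps (l @ l') j = swps l (swps l' j)"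
  by (induction l) auto

lemma swp_swp [simp]: "swp i (swp i j) = j"
  by (simp add: swp_def)

lemma swps_rev: "swps (rev l) (swps l j) = j"
proof (induction l)
  case (Cons i l)
  have "swps (rev (i # l)) (swps (i # l) j) = swps (rev l) (swp i (swp i (swps l j)))"
    by (simp add: swps_append)
  then show ?case using Cons by simp
qed simp

lemma swp_le: "i \<le> k \<Longrightarrow> j \<le> k + 1 \<Longrightarrow> swp i j \<le> k + 1"
  by (simp add: swp_def)

lemma swps_upt: "swps [0..<N] j = (if j < N then j + 1 else if j = N then 0 else j)"
proof (induction N arbitrary: j)
  case (Suc N)
  have "swps [0..<Suc N] j = swps [0..<N] (swp N j)" by (simp add: swps_append)
  then show ?case unfolding Suc by (auto simp: swp_def)
qed simp

text \<open>To reverse \<open>{0..Suc N}\<close>, first reverse \<open>{0..N}\<close>, then apply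
  the cycle that raises these by one and sends \<open>Suc N\<close> to \<open>0\<close>.\<close>

fun reversal_word :: "nat \<Rightarrow> nat list" where
  "reversal_word 0 = []"
| "reversal_word (Suc N) = [0..<Suc N] @ reversal_word N"

lemma swps_reversal_word: "j \<le> N \<Longrightarrow> swps (reversal_word N) j = N - j"
proof -
  have "swps (reversal_word N) j = (if j \<le> N then N - j else j)"
  proof (induction N)
    case (Suc N)
    have "swps (reversal_word (Suc N)) j = swps [0..<Suc N] (swps (reversal_word N) j)"
      by (simp only: reversal_word.simps swps_append)
    then show ?case unfolding Suc swps_upt by (auto split: if_splits)
  qed simp
  then show "j \<le> N \<Longrightarrow> swps (reversal_word N) j = N - j" by simp
qed

lemma length_reversal_word: "2 * length (reversal_word N) = N * (N + 1)"
  by (induction N) auto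

lemma set_reversal_word: "set (reversal_word N) \<subseteq> {..<N}"
  by (induction N) auto

text \<open>Odd \<open>k\<close> suffices for rotations and for the analysis of automorphisms; the
  residue modulo 4 enters only with the reflection.\<close>

locale stable_kneser =
  fixes n k m :: nat
  assumes n_ge: "n \<ge> 2" and k_ge: "k \<ge> 3" and odd_k: "odd k" and m_def: "m = 2*n+k"
begin

abbreviation V :: "nat set set" where "V \<equiv> SG_verts n k"
abbreviation col :: "nat set \<Rightarrow> nat" where "col \<equiv> canon_col n k"

section \<open>The cycle of length \<open>m\<close> and its dihedral automorphisms\<close>

definition nx :: "nat \<Rightarrow> nat" where
  "nx x = (if x + 1 = m then 0 else x + 1)"

lemma m_ge: "m \<ge> 7" "m \<ge> 2*n+3" using n_ge k_ge m_def by auto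

lemma k_less: "k + 1 < m" using n_ge m_def by simp

lemma odd_m: "odd m" using odd_k m_def by simp

lemma V_iff: "S \<in> V \<longleftrightarrow> S \<subseteq> {..<m} \<and> card S = n \<and> (\<forall>x\<in>S. nx x \<notin> S)"
proof
  assume S: "S \<in> V"
  have "nx x \<notin> S" if x: "x \<in> S" for x
  proof (cases "x + 1 = m")
    case True
    then have "x = 2*n+k-1" using m_def by simp
    then have "0 \<notin> S" using S x by (auto simp: SG_verts_def stable_def)
    then show ?thesis using True by (simp add: nx_def)
  next
    case False
    then show ?thesis using SG_verts_Suc[OF S x] by (simp add: nx_def)
  qed
  then show "S \<subseteq> {..<m} \<and> card S = n \<and> (\<forall>x\<in>S. nx x \<notin> S)"
    using SG_vertsD[OF S] by (auto simp: m_def)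
next
  assume S: "S \<subseteq> {..<m} \<and> card S = n \<and> (\<forall>x\<in>S. nx x \<notin> S)"
  have "\<not> {i, i+1} \<subseteq> S" if "i + 1 < m" for i
    using S that by (auto simp: nx_def split: if_splits)
  moreover have "\<not> {0, m-1} \<subseteq> S"
  proof
    assume a: "{0, m-1} \<subseteq> S"
    have "nx (m-1) = 0" using m_ge by (simp add: nx_def)
    then show False using a S by auto
  qed
  ultimately show "S \<in> V" using S by (auto simp: SG_verts_def stable_def m_def)
qed

lemma finite_V: "S \<in> V \<Longrightarrow> finite S"
  using SG_vertsD(3) .

lemma nx_less: "x < m \<Longrightarrow> nx x < m"
  by (auto simp: nx_def)

lemma nx_inj: "x < m \<Longrightarrow> y < m \<Longrightarrow> nx x = nx y \<longleftrightarrow> x = y"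
  by (auto simp: nx_def split: if_splits)

lemma nx_surj: "x < m \<Longrightarrow> \<exists>y<m. nx y = x"
  using m_ge by (intro exI[of _ "if x = 0 then m - 1 else x - 1"]) (auto simp: nx_def)

text \<open>Induction once around the cycle from any starting point: up to \<open>m - 1\<close>,
  across to \<open>0\<close>, and up again.\<close>

lemma cyc_induct:
  assumes "P a" "a < m" "\<And>y. y < m \<Longrightarrow> P y \<Longrightarrow> P (nx y)" "x < m"
  shows "P x"
proof -
  have up: "P y" if "P b" "b \<le> y" "y < m" for b y
    using that(2,3,1)
  proof (induction y rule: dec_induct)
    case (step y)
    then show ?case using assms(3)[of y] by (simp add: nx_def split: if_splits)
  qed
  have "P (m - 1)" by (rule up[OF assms(1)]) (use assms(2) in auto)
  then have "P 0" using assms(3)[of "m-1"] m_ge by (simp add: nx_def)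
  then show ?thesis using up assms(4) by blast
qed

text \<open>The alternatives say that \<open>d\<close> keeps or reverses the orientation of the
  cycle; the second is phrased so that no predecessor function is needed. Bijectivity on
  \<open>V\<close> follows from injectivity by finiteness.\<close>

lemma aut_image:
  assumes lt: "\<And>x. x < m \<Longrightarrow> d x < m" and inj: "inj_on d {..<m}"
    and dih: "(\<forall>x<m. d (nx x) = nx (d x)) \<or> (\<forall>x<m. nx (d (nx x)) = d x)"
  shows "SG_aut n k ((`) d)"
proof -
  have sub: "S \<subseteq> {..<m}" if "S \<in> V" for S using that V_iff by auto
  have im: "d ` S \<in> V" if S: "S \<in> V" for S
  proof -
    have "nx (d x) \<noteq> d y" if xy: "x \<in> S" "y \<in> S" for x y
    proof
      assume e: "nx (d x) = d y"
      have xm: "x < m" "y < m" using sub[OF S] xy by auto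
      from dih show False
      proof
        assume "\<forall>x<m. d (nx x) = nx (d x)"
        then have "nx x = y" using e xm inj_onD[OF inj, of "nx x" y] nx_less by simp
        then show False using S xy V_iff by auto
      next
        assume "\<forall>x<m. nx (d (nx x)) = d x"
        then have "nx (d (nx y)) = nx (d x)" using e xm by simp
        then have "nx y = x" using xm lt nx_less nx_inj inj_onD[OF inj, of "nx y" x] by auto
        then show False using S xy V_iff by auto
      qed
    qed
    moreover have "card (d ` S) = n"
      using S V_iff card_image[OF inj_on_subset[OF inj sub[OF S]]] by auto
    ultimately show ?thesis using S sub[OF S] lt by (auto simp: V_iff)
  qed
  have "inj_on ((`) d) V"
    by (intro inj_onI) (metis inj inj_on_image_eq_iff sub)
  then have "bij_betw ((`) d) V V"
    using im endo_inj_surj[OF finite_SG_verts, of "(`) d" n k]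
    by (simp add: bij_betw_def image_subset_iff)
  moreover have "SG_adj S T \<longleftrightarrow> SG_adj (d ` S) (d ` T)" if "S \<in> V" "T \<in> V" for S T
    using inj_on_image_Int[OF inj sub[OF that(1)] sub[OF that(2)]] unfolding SG_adj_def
    by (metis image_is_empty)
  ultimately show ?thesis by (auto simp: SG_aut_def)
qed

lemma SG_autD:
  assumes "SG_aut n k \<gamma>"
  shows "S \<in> V \<Longrightarrow> \<gamma> S \<in> V"
    and "S \<in> V \<Longrightarrow> T \<in> V \<Longrightarrow> SG_adj (\<gamma> S) (\<gamma> T) \<longleftrightarrow> SG_adj S T"
    and "S \<in> V \<Longrightarrow> T \<in> V \<Longrightarrow> \<gamma> S = \<gamma> T \<longleftrightarrow> S = T"
    and "T \<in> V \<Longrightarrow> \<exists>S\<in>V. \<gamma> S = T"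
proof -
  have b: "inj_on \<gamma> V" "\<gamma> ` V = V" and a: "\<forall>S\<in>V. \<forall>T\<in>V. SG_adj S T \<longleftrightarrow> SG_adj (\<gamma> S) (\<gamma> T)"
    using assms by (simp_all add: SG_aut_def bij_betw_def)
  show "S \<in> V \<Longrightarrow> \<gamma> S \<in> V" using b(2) by (metis imageI)
  show "S \<in> V \<Longrightarrow> T \<in> V \<Longrightarrow> SG_adj (\<gamma> S) (\<gamma> T) \<longleftrightarrow> SG_adj S T" using a by simp
  show "S \<in> V \<Longrightarrow> T \<in> V \<Longrightarrow> \<gamma> S = \<gamma> T \<longleftrightarrow> S = T" by (rule inj_on_eq_iff[OF b(1)])
  show "T \<in> V \<Longrightarrow> \<exists>S\<in>V. \<gamma> S = T" using b(2) by (metis imageE)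
qed

lemma SG_aut_comp: "SG_aut n k \<gamma> \<Longrightarrow> SG_aut n k \<delta> \<Longrightarrow> SG_aut n k (\<lambda>S. \<gamma> (\<delta> S))"
proof -
  assume g: "SG_aut n k \<gamma>" and d: "SG_aut n k \<delta>"
  have "bij_betw (\<gamma> \<circ> \<delta>) V V"
    using g d unfolding SG_aut_def by (blast intro: bij_betw_trans)
  then show ?thesis
    unfolding SG_aut_def o_def using SG_autD(1,2)[OF g] SG_autD(1,2)[OF d] by blast
qed

lemma aut_nx: "SG_aut n k ((`) nx)"
  by (rule aut_image) (auto simp: nx_less nx_inj inj_on_def)

section \<open>Colour permutations that preserve the component of \<open>col\<close>\<close>

definition good :: "(nat \<Rightarrow> nat) \<Rightarrow> bool" where
  "good \<pi> \<longleftrightarrow> inj_on \<pi> {0..k+1} \<and> \<pi> ` {0..k+1} \<subseteq> {0..k+1} \<and> hom_conn n k col (\<lambda>S\<in>V. \<pi> (col S))"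

lemma col_hom: "col \<in> SG_hom n k"
  using canon_col_hom n_ge by simp

lemma col_le: "S \<in> V \<Longrightarrow> col S \<le> k + 1"
  using SG_homD(1)[OF col_hom] .

lemma goodD:
  assumes "good \<pi>"
  shows "inj_on \<pi> {0..k+1}" "\<pi> ` {0..k+1} \<subseteq> {0..k+1}" "hom_conn n k col (\<lambda>S\<in>V. \<pi> (col S))"
  using assms by (auto simp: good_def)

lemma conn_post:
  assumes "hom_conn n k (\<lambda>S\<in>V. f S) (\<lambda>S\<in>V. g S)" "inj_on \<pi> {0..k+1}" "\<pi> ` {0..k+1} \<subseteq> {0..k+1}"
  shows "hom_conn n k (\<lambda>S\<in>V. \<pi> (f S)) (\<lambda>S\<in>V. \<pi> (g S))"
proof -
  have e: "(\<lambda>S\<in>V. \<pi> (restrict h V S)) = (\<lambda>S\<in>V. \<pi> (h S))" for h :: "nat set \<Rightarrow> nat"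
    by (rule restrict_ext) simp
  show ?thesis using hom_conn_postcomp[OF assms] unfolding e .
qed

lemma conn_pre:
  assumes "hom_conn n k (\<lambda>S\<in>V. f S) (\<lambda>S\<in>V. g S)" "SG_aut n k \<gamma>"
  shows "hom_conn n k (\<lambda>S\<in>V. f (\<gamma> S)) (\<lambda>S\<in>V. g (\<gamma> S))"
proof -
  have e: "(\<lambda>S\<in>V. restrict h V (\<gamma> S)) = (\<lambda>S\<in>V. h (\<gamma> S))" for h :: "nat set \<Rightarrow> nat"
    by (rule restrict_ext) (simp add: SG_autD(1)[OF assms(2)])
  have "hom_conn n k (\<lambda>S\<in>V. restrict f V (\<gamma> S)) (\<lambda>S\<in>V. restrict g V (\<gamma> S))"
    by (rule hom_conn_precomp[OF assms(1)]) (simp_all add: SG_autD[OF assms(2)])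
  then show ?thesis unfolding e .
qed

lemma col_restrict: "(\<lambda>S\<in>V. col S) = col"
  by (auto simp: canon_col_def)

lemmas conn_post_col = conn_post[where f = col, unfolded col_restrict]

text \<open>The path for \<open>\<rho>\<close>, pushed through \<open>\<pi>\<close>, continues the
  path for \<open>\<pi>\<close>. Together with \<open>good_inv\<close> this makes the good
  permutations a group.\<close>

lemma good_comp:
  assumes "good \<pi>" "good \<rho>"
  shows "good (\<lambda>j. \<pi> (\<rho> j))"
proof -
  note a = goodD[OF assms(1)] and b = goodD[OF assms(2)]
  have "hom_conn n k (\<lambda>S\<in>V. \<pi> (col S)) (\<lambda>S\<in>V. \<pi> (\<rho> (col S)))"
    by (rule conn_post_col[OF b(3) a(1,2)])
  then have "hom_conn n k col (\<lambda>S\<in>V. \<pi> (\<rho> (col S)))" using a(3) hom_conn_trans by blast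
  moreover have "inj_on (\<lambda>j. \<pi> (\<rho> j)) {0..k+1}"
    using comp_inj_on[OF b(1) inj_on_subset[OF a(1) b(2)]] by (simp add: o_def)
  ultimately show ?thesis using a b by (auto simp: good_def image_subset_iff)
qed

lemma good_cong:
  assumes "good \<pi>" "\<And>j. j \<le> k + 1 \<Longrightarrow> \<pi> j = \<rho> j"
  shows "good \<rho>"
proof -
  have "(\<lambda>S\<in>V. \<pi> (col S)) = (\<lambda>S\<in>V. \<rho> (col S))"
    by (rule restrict_ext) (rule assms(2)[OF col_le])
  moreover have "inj_on \<rho> {0..k+1} \<longleftrightarrow> inj_on \<pi> {0..k+1}" by (rule inj_on_cong) (simp add: assms(2))
  moreover have "\<rho> ` {0..k+1} = \<pi> ` {0..k+1}" by (rule image_cong) (simp_all add: assms(2))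
  ultimately show ?thesis using goodD[OF assms(1)] by (simp add: good_def)
qed

lemma good_inv:
  assumes "good \<pi>" "inj_on \<rho> {0..k+1}" "\<rho> ` {0..k+1} \<subseteq> {0..k+1}" "\<And>j. j \<le> k + 1 \<Longrightarrow> \<rho> (\<pi> j) = j"
  shows "good \<rho>"
proof -
  have "hom_conn n k (\<lambda>S\<in>V. \<rho> (col S)) (\<lambda>S\<in>V. \<rho> (\<pi> (col S)))"
    by (rule conn_post_col[OF goodD(3)[OF assms(1)] assms(2,3)])
  moreover have "(\<lambda>S\<in>V. \<rho> (\<pi> (col S))) = col"
    by (subst (2) col_restrict[symmetric]) (rule restrict_ext, rule assms(4)[OF col_le])
  ultimately show ?thesis using assms hom_conn_sym by (simp add: good_def)
qed

definition \<tau> :: "nat \<Rightarrow> nat" where "\<tau> j = (if j = 0 then k + 1 else j - 1)"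

lemma \<tau>_perm: "inj_on \<tau> {0..k+1}" "\<tau> ` {0..k+1} \<subseteq> {0..k+1}"
  by (auto simp: \<tau>_def inj_on_def)

lemma col_Min: "S \<in> V \<Longrightarrow> col S = Min S"
  by (simp add: canon_col_def)

lemma nx_image_Min:
  assumes "S \<in> V"
  shows "Min (nx ` S) = (if m - 1 \<in> S then 0 else Min S + 1)"
proof -
  have S: "S \<subseteq> {..<m}" "finite S" "S \<noteq> {}" using assms V_iff SG_vertsD(3,4)[OF assms] n_ge by auto
  show ?thesis
  proof (cases "m - 1 \<in> S")
    case True
    have "nx (m - 1) = 0" using m_ge by (simp add: nx_def)
    then have "0 \<in> nx ` S" using True by (metis imageI)
    then have "Min (nx ` S) \<le> 0" using S by (intro Min_le) auto
    then show ?thesis using True by simp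
  next
    case False
    have e: "nx x = x + 1" if "x \<in> S" for x
      using that False S m_ge by (auto simp: nx_def)
    then have "nx ` S = Suc ` S" by simp
    then show ?thesis using False S mono_Min_commute[OF mono_Suc, of S] by simp
  qed
qed

text \<open>
  Both sides are \<open>Min\<close>, except that on the right every set containing \<open>m - 1\<close> has
  colour \<open>k + 1\<close>.
\<close>

lemma conn_rotation: "hom_conn n k col (\<lambda>S\<in>V. \<tau> (col (nx ` S)))"
proof (rule hom_conn_mix[OF col_hom])
  have f: "col (nx ` S) = (if m - 1 \<in> S then 0 else Min S + 1)" if "S \<in> V" for S
    using nx_image_Min[OF that] col_Min SG_autD(1)[OF aut_nx that] by simp
  have "(\<lambda>S\<in>V. col (nx ` S)) \<in> SG_hom n k"
    by (rule SG_hom_precomp[OF col_hom]) (simp_all add: SG_autD[OF aut_nx])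
  then have "(\<lambda>S\<in>V. \<tau> ((\<lambda>S\<in>V. col (nx ` S)) S)) \<in> SG_hom n k"
    by (rule SG_hom_postcomp[OF _ \<tau>_perm])
  moreover have "(\<lambda>S\<in>V. \<tau> ((\<lambda>S\<in>V. col (nx ` S)) S)) = (\<lambda>S\<in>V. \<tau> (col (nx ` S)))"
    by (rule restrict_ext) simp
  ultimately show "(\<lambda>S\<in>V. \<tau> (col (nx ` S))) \<in> SG_hom n k" by simp
  fix S T assume st: "S \<in> V" "T \<in> V" "SG_adj S T"
  have "n \<ge> 1" using n_ge by simp
  note minS = Min_SG_verts[OF st(1) this] and minT = Min_SG_verts[OF st(2) this]
  show "col S \<noteq> (\<lambda>S\<in>V. \<tau> (col (nx ` S))) T"
  proof (cases "m - 1 \<in> T")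
    case True
    then have "m - 1 \<notin> S" using st(3) by (auto simp: SG_adj_def)
    \<comment> \<open>On the right \<open>T\<close> has colour \<open>k + 1\<close>, which a set
      missing the last point cannot have as minimum.\<close>
    then have "Min S \<le> k" using minS(3) m_def by simp
    then show ?thesis using True st f col_Min by (simp add: \<tau>_def)
  next
    case False
    have "Min S \<noteq> Min T" using minS(1) minT(1) st(3) by (auto simp: SG_adj_def)
    then show ?thesis using False st f col_Min by (simp add: \<tau>_def)
  qed
qed

text \<open>Rotating and applying \<open>\<tau>\<close> turns the path from \<open>col\<close> to
  \<open>\<pi>\<close> after \<open>col\<close> into one whose start is connected to
  \<open>col\<close> and whose end is connected to \<open>\<rho>\<close> after \<open>col\<close>,
  both by \<open>conn_rotation\<close>.\<close>

lemma good_conj: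
  assumes "good \<pi>" "inj_on \<rho> {0..k+1}" "\<rho> ` {0..k+1} \<subseteq> {0..k+1}"
    and "\<And>j. j \<le> k + 1 \<Longrightarrow> \<tau> (\<pi> j) = \<rho> (\<tau> j)"
  shows "good \<rho>"
proof -
  have "hom_conn n k (\<lambda>S\<in>V. col S) (\<lambda>S\<in>V. \<pi> (col S))"
    using goodD(3)[OF assms(1)] col_restrict by simp
  from conn_post[OF conn_pre[OF this aut_nx] \<tau>_perm]
  have 1: "hom_conn n k (\<lambda>S\<in>V. \<tau> (col (nx ` S))) (\<lambda>S\<in>V. \<tau> (\<pi> (col (nx ` S))))" .
  have "(\<lambda>S\<in>V. \<tau> (\<pi> (col (nx ` S)))) = (\<lambda>S\<in>V. \<rho> (\<tau> (col (nx ` S))))"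
    by (rule restrict_ext) (rule assms(4)[OF col_le[OF SG_autD(1)[OF aut_nx]]])
  then have 2: "hom_conn n k col (\<lambda>S\<in>V. \<rho> (\<tau> (col (nx ` S))))"
    using hom_conn_trans[OF conn_rotation 1] by simp
  have "hom_conn n k (\<lambda>S\<in>V. \<rho> (col S)) (\<lambda>S\<in>V. \<rho> (\<tau> (col (nx ` S))))"
    by (rule conn_post_col[OF conn_rotation assms(2,3)])
  then show ?thesis using 2 hom_conn_trans hom_conn_sym assms(2,3) unfolding good_def by blast
qed

lemma swps_perm:
  assumes "set l \<subseteq> {..k}"
  shows "inj_on (swps l) {0..k+1}" "swps l ` {0..k+1} \<subseteq> {0..k+1}"
proof -
  have "swps l j \<le> k + 1" if "j \<le> k + 1" for j
    using assms that
  proof (induction l)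
    case (Cons i l)
    then show ?case using swp_le[of i k "swps l j"] by simp
  qed simp
  then show "swps l ` {0..k+1} \<subseteq> {0..k+1}" by (intro image_subsetI) (simp del: add_Suc_right)
  show "inj_on (swps l) {0..k+1}" by (rule inj_on_inverseI) (rule swps_rev)
qed

text \<open>Conjugation by \<open>\<tau>\<close> lowers the three colours by one, so the induction
  descends from the top triple \<open>k-1, k, k+1\<close>.\<close>

lemma good_swp_Suc:
  assumes "i < k"
  shows "good (swps [Suc i, i])"
proof -
  have "i \<le> k - 1" using assms by simp
  then show ?thesis
  proof (induction i rule: inc_induct)
    case base
    have "Suc (k - 1) = k" using k_ge by simp
    moreover have e: "swps [k, k - 1] = (\<lambda>j. swp k (swp (k - 1) j))" by auto
    have "good (swps [k, k - 1])"
      using canon_col_three_cycle[of n k] n_ge k_ge swps_perm[of "[k, k-1]"]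
      unfolding good_def e by simp
    ultimately show ?case by (simp only:)
  next
    case (step i)
    show ?case
      by (rule good_conj[OF step(3) swps_perm]) (use step(2) in \<open>auto simp: \<tau>_def swp_def\<close>)
  qed
qed

lemma good_Nil: "good (swps [])"
  using col_hom col_restrict hom_conn_refl swps_perm[of "[]"] by (simp add: good_def)

text \<open>The two inner copies of \<open>swp i\<close> in \<open>[Suc i, i]\<close> followed by
  \<open>[i, j]\<close> cancel, so products of neighbouring transpositions telescope; inversion
  gives the other order.\<close>

lemma good_swp_swp:
  assumes "i \<le> k" "j \<le> k"
  shows "good (swps [i, j])"
proof -
  have down: "good (swps [i, j])" if "j \<le> i" "i \<le> k" for i j
    using that
  proof (induction i rule: dec_induct)
    case base
    show ?case by (rule good_cong[OF good_Nil]) simp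
  next
    case (step i)
    then have "good (swps [Suc i, i])" "good (swps [i, j])" by (auto simp del: swps.simps intro: good_swp_Suc)
    then have "good (\<lambda>x. swps [Suc i, i] (swps [i, j] x))"
      by (rule good_comp)
    then show ?case by (rule good_cong) simp
  qed
  show ?thesis
  proof (cases "j \<le> i")
    case False
    have "good (swps [j, i])" using False down assms by simp
    then show ?thesis by (rule good_inv) (use swps_perm[of "[i, j]"] assms in simp_all)
  qed (use down assms in simp)
qed

lemma good_even_word: "even (length l) \<Longrightarrow> set l \<subseteq> {..k} \<Longrightarrow> good (swps l)"
proof (induction l rule: induct_list012)
  case 1
  show ?case by (rule good_Nil)
next
  case (3 i j l)
  have "i \<le> k" "j \<le> k" "set l \<subseteq> {..k}" "even (length l)" using 3(3,4) by simp_all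
  then have "good (swps [i, j])" "good (swps l)" using good_swp_swp 3(1) by blast+
  then have "good (\<lambda>x. swps [i, j] (swps l x))"
    by (rule good_comp)
  then show ?case by (rule good_cong) simp
qed simp

section \<open>Rotations and reflections preserve the component\<close>

definition preserves_component :: "(nat set \<Rightarrow> nat set) \<Rightarrow> bool" where
  "preserves_component \<gamma> \<longleftrightarrow> hom_conn n k col (\<lambda>S\<in>V. col (\<gamma> S))"

text \<open>Precomposing the path for \<open>\<delta>\<close> with \<open>\<gamma>\<close> connects
  the colourings of \<open>\<gamma>\<close> and of the composite. This lets rotations and
  reflections be stripped off an automorphism.\<close>

lemma preserves_component_cancel:
  assumes "preserves_component \<delta>" "SG_aut n k \<gamma>" "preserves_component (\<lambda>S. \<delta> (\<gamma> S))"
  shows "preserves_component \<gamma>"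
proof -
  have "hom_conn n k (\<lambda>S\<in>V. col (\<gamma> S)) (\<lambda>S\<in>V. col (\<delta> (\<gamma> S)))"
    using conn_pre[where f = col and g = "\<lambda>S. col (\<delta> S)", unfolded col_restrict, OF _ assms(2)] assms(1)
    unfolding preserves_component_def .
  then show ?thesis using assms(3) hom_conn_trans[OF _ hom_conn_sym]
    unfolding preserves_component_def by blast
qed

text \<open>The path to \<open>\<rho>\<close> after \<open>col\<close> after
  \<open>\<gamma>\<close>, pushed through the left inverse \<open>\<pi>\<close>, ends at
  \<open>col\<close> after \<open>\<gamma>\<close>, and its start is connected to \<open>col\<close>
  because \<open>\<pi>\<close> is good.\<close>

lemma preserves_component_good:
  assumes "good \<pi>" "hom_conn n k col (\<lambda>S\<in>V. \<rho> (col (\<gamma> S)))" "SG_aut n k \<gamma>"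
    and "\<And>j. j \<le> k + 1 \<Longrightarrow> \<pi> (\<rho> j) = j"
  shows "preserves_component \<gamma>"
proof -
  have "hom_conn n k (\<lambda>S\<in>V. \<pi> (col S)) (\<lambda>S\<in>V. \<pi> (\<rho> (col (\<gamma> S))))"
    by (rule conn_post_col[OF assms(2) goodD(1,2)[OF assms(1)]])
  moreover have "(\<lambda>S\<in>V. \<pi> (\<rho> (col (\<gamma> S)))) = (\<lambda>S\<in>V. col (\<gamma> S))"
    by (rule restrict_ext) (rule assms(4)[OF col_le[OF SG_autD(1)[OF assms(3)]]])
  ultimately show ?thesis
    using goodD(3)[OF assms(1)] hom_conn_trans unfolding preserves_component_def by metis
qed

lemma preserves_component_nx: "preserves_component ((`) nx)"
proof (rule preserves_component_good[OF _ conn_rotation aut_nx])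
  \<comment> \<open>The inverse of \<open>\<tau>\<close> is a cycle of length \<open>k + 2\<close>,
    a word of length \<open>k + 1\<close>, which is even because \<open>k\<close> is odd.\<close>
  show "good (swps [0..<k+1])" by (rule good_even_word) (use odd_k in auto)
  show "swps [0..<k+1] (\<tau> j) = j" if "j \<le> k + 1" for j
    unfolding swps_upt using that by (auto simp: \<tau>_def)
qed

text \<open>This is \<open>k + 1 - x\<close> modulo \<open>m\<close>, the reflection of the cycle
  that maps the range of colours \<open>{0..k+1}\<close> to itself.\<close>

definition reflect :: "nat \<Rightarrow> nat" where
  "reflect x = (if x \<le> k + 1 then k + 1 - x else m + k + 1 - x)"

lemma nx_reflect: "x < m \<Longrightarrow> nx (reflect (nx x)) = reflect x"
  using k_less by (auto simp: nx_def reflect_def)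

lemma reflect_less: "x < m \<Longrightarrow> reflect x < m"
  using k_less by (auto simp: reflect_def)

lemma reflect_inj: "inj_on reflect {..<m}"
  using k_less by (auto simp: inj_on_def reflect_def split: if_splits)

lemma aut_reflect: "SG_aut n k ((`) reflect)"
  by (rule aut_image) (use nx_reflect reflect_less reflect_inj in auto)

text \<open>
  Both \<open>col\<close> and the reversed colouring pick an element of \<open>S \<inter> {0..k+1}\<close>, the least and the
  greatest one; disjoint sets cannot pick the same element.
\<close>

lemma conn_reflection: "hom_conn n k col (\<lambda>S\<in>V. k + 1 - col (reflect ` S))"
proof (rule hom_conn_mix[OF col_hom])
  have n1: "n \<ge> 1" using n_ge by simp
  have f: "k + 1 - col (reflect ` S) \<in> S" if "S \<in> V" for S
  proof -
    have r: "reflect ` S \<in> V" using SG_autD(1)[OF aut_reflect that] .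
    then obtain x where x: "x \<in> S" "reflect x = col (reflect ` S)"
      using Min_SG_verts(1)[OF r n1] col_Min by auto
    have "x < m" using x(1) that V_iff by auto
    moreover have "reflect x \<le> k + 1" using col_le[OF r] x(2) by simp
    ultimately have "k + 1 - reflect x = x" by (auto simp: reflect_def split: if_splits)
    then show ?thesis using x by simp
  qed
  have disj: "k + 1 - col (reflect ` S) \<noteq> k + 1 - col (reflect ` T)" "col S \<noteq> k + 1 - col (reflect ` T)"
    if "S \<in> V" "T \<in> V" "SG_adj S T" for S T
    using f[OF that(1)] f[OF that(2)] Min_SG_verts(1)[OF that(1) n1] col_Min that
    by (auto simp: SG_adj_def)
  show "(\<lambda>S\<in>V. k + 1 - col (reflect ` S)) \<in> SG_hom n k"
    using disj by (auto simp: SG_hom_def)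
  show "col S \<noteq> (\<lambda>S\<in>V. k + 1 - col (reflect ` S)) T" if "S \<in> V" "T \<in> V" "SG_adj S T" for S T
    using disj that by simp
qed

lemma preserves_component_reflect:
  assumes "k mod 4 = 3"
  shows "preserves_component ((`) reflect)"
proof (rule preserves_component_good[OF _ conn_reflection aut_reflect])
  obtain q where q: "k = 4 * q + 3" using assms by (metis mult_div_mod_eq)
  \<comment> \<open>Here \<open>k mod 4 = 3\<close> makes the reversal of the \<open>k + 2\<close>
    colours an even permutation.\<close>
  have "2 * length (reversal_word (k + 1)) = (4*q+4) * (4*q+5)"
    unfolding length_reversal_word q by (simp add: algebra_simps)
  then have "length (reversal_word (k + 1)) = 2 * ((q+1) * (4*q+5))" by (simp add: algebra_simps)
  then show "good (swps (reversal_word (k + 1)))"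
    using set_reversal_word[of "k+1"] by (intro good_even_word) auto
  show "swps (reversal_word (k + 1)) (k + 1 - j) = j" if "j \<le> k + 1" for j
    by (subst swps_reversal_word) (use that in auto)
qed

end

section \<open>Elementary moves\<close>

context stable_kneser
begin

lemma V_D:
  assumes "S \<in> V"
  shows "x \<in> S \<Longrightarrow> x < m" "x \<in> S \<Longrightarrow> nx x \<notin> S" "card S = n" "finite S"
  using assms V_iff finite_V by auto

lemma V_subset_eq: "S \<in> V \<Longrightarrow> T \<in> V \<Longrightarrow> S \<subseteq> T \<Longrightarrow> S = T"
  using card_subset_eq V_D(3,4) by metis

lemma nx_neq: "x < m \<Longrightarrow> nx x \<noteq> x" "x < m \<Longrightarrow> nx (nx x) \<noteq> x"
  using m_ge by (auto simp: nx_def)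

lemma V_swap:
  assumes "S \<in> V" "x \<in> S" "y < m" "y \<notin> S" "nx y \<in> S \<Longrightarrow> nx y = x"
    "\<And>z. z \<in> S \<Longrightarrow> nx z = y \<Longrightarrow> z = x"
  shows "insert y (S - {x}) \<in> V"
proof -
  have "card (insert y (S - {x})) = n"
    using V_D(3,4)[OF assms(1)] assms(2,4) n_ge by (simp add: card_Diff_singleton)
  then show ?thesis
    using assms V_D(1,2)[OF assms(1)] nx_neq(1)[OF assms(3)] by (auto simp: V_iff)
qed

text \<open>The label \<open>x\<close> stands for the edge \<open>{x, nx x}\<close> of the cycle.\<close>

definition lab :: "nat set \<Rightarrow> nat set \<Rightarrow> nat \<Rightarrow> bool" where
  "lab S T x \<longleftrightarrow> S \<in> V \<and> T \<in> V \<and> x < m \<and> (S - T) \<union> (T - S) = {x, nx x}"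

definition moved :: "nat set \<Rightarrow> nat set \<Rightarrow> bool" where
  "moved S T \<longleftrightarrow> (\<exists>x. lab S T x)"

text \<open>The last clause is the toggling form of a move: membership changes exactly at the two
  ends of the edge. Parity arguments below rest on it.\<close>

lemma labD:
  assumes "lab S T x"
  shows "S \<in> V" "T \<in> V" "x < m" "p \<in> T \<longleftrightarrow> (p \<in> S \<longleftrightarrow> p \<noteq> x \<and> p \<noteq> nx x)"
  using assms unfolding lab_def by (auto simp: set_eq_iff)

lemma lab_sym: "lab S T x \<longleftrightarrow> lab T S x"
  by (auto simp: lab_def Un_commute)

lemma lab_neq: "lab S T x \<Longrightarrow> S \<noteq> T"
  by (auto simp: lab_def)

lemma lab_cases:
  assumes "lab S T x"
  shows "(x \<in> S \<and> nx x \<notin> S \<and> x \<notin> T \<and> nx x \<in> T) \<or> (x \<notin> S \<and> nx x \<in> S \<and> x \<in> T \<and> nx x \<notin> T)"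
  using labD(4)[OF assms] V_D(2)[OF labD(1)[OF assms]] V_D(2)[OF labD(2)[OF assms]] by metis

lemma lab_unique:
  assumes "lab S T x" "lab S T y"
  shows "x = y"
proof -
  have "{x, nx x} = {y, nx y}" using assms by (auto simp: lab_def)
  then show ?thesis using nx_neq labD(3)[OF assms(1)] labD(3)[OF assms(2)]
    by (metis doubleton_eq_iff)
qed

lemma lab_target_unique: "lab S T x \<Longrightarrow> lab S U x \<Longrightarrow> T = U"
  using labD(4) by blast

lemma lab_forward:
  assumes "S \<in> V" "x \<in> S" "nx (nx x) \<notin> S"
  shows "lab S (insert (nx x) (S - {x})) x"
proof -
  have x: "x < m" "nx x \<notin> S" using V_D assms by auto
  have "insert (nx x) (S - {x}) \<in> V"
    by (rule V_swap) (use assms x nx_less nx_inj V_D(1) in auto)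
  then show ?thesis using assms x by (auto simp: lab_def)
qed

lemma lab_backward:
  assumes "S \<in> V" "x < m" "nx x \<in> S" "\<And>z. z \<in> S \<Longrightarrow> nx z \<noteq> x"
  shows "lab S (insert x (S - {nx x})) x"
proof -
  have x: "x \<notin> S" using V_D(2) assms(1,3) by auto
  have "insert x (S - {nx x}) \<in> V"
    by (rule V_swap) (use assms x in auto)
  then show ?thesis using assms x by (auto simp: lab_def)
qed

section \<open>Recognising moves by common neighbours\<close>

lemma nx_image_V: "S \<in> V \<Longrightarrow> nx ` S \<in> V"
  using SG_autD(1)[OF aut_nx] .

lemma nx_mem_image: "S \<in> V \<Longrightarrow> x < m \<Longrightarrow> nx x \<in> nx ` S \<longleftrightarrow> x \<in> S"
  using V_D(1) nx_inj by auto

text \<open>Oriented so that the move goes forward from \<open>S\<close> to \<open>T\<close>, the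
  rotated copy of \<open>T\<close> is disjoint from both. It misses \<open>nx v\<close>, so at most
  one of its elements is a neighbour of \<open>v\<close>; exchanging that one, or any other if there
  is none, for \<open>v\<close> gives \<open>W\<close>.\<close>

lemma ex_V_disjoint_through:
  assumes "lab S T x" "v < m" "v \<notin> S" "v \<notin> T"
  shows "\<exists>W\<in>V. S \<inter> W = {} \<and> T \<inter> W = {} \<and> v \<in> W"
proof -
  have *: "\<exists>W\<in>V. S \<inter> W = {} \<and> T \<inter> W = {} \<and> v \<in> W"
    if l: "lab S T x" and x: "x \<in> S" "nx x \<in> T" and v: "v \<notin> S" "v \<notin> T" for S T
  proof -
    note S = labD(1)[OF l] and T = labD(2)[OF l] and mem = labD(4)[OF l] and xm = labD(3)[OF l]
    let ?W = "nx ` T"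
    have W: "?W \<in> V" using nx_image_V[OF T] .
    have dT: "T \<inter> ?W = {}" using V_D(2)[OF T] by auto
    have dS: "S \<inter> ?W = {}"
    proof -
      have "nx t \<notin> S" if t: "t \<in> T" for t
      proof
        assume a: "nx t \<in> S"
        have "nx t \<notin> T" using V_D(2)[OF T t] .
        then have "nx t = x" using a mem[of "nx t"] x V_D(2)[OF S] by auto
        then have "t \<noteq> nx x" using nx_neq(2)[OF xm] by auto
        moreover have "t \<noteq> x" using nx_neq(1)[OF xm] \<open>nx t = x\<close> by auto
        ultimately have "t \<in> S" using mem[of t] t by auto
        then show False using V_D(2)[OF S] a by auto
      qed
      then show ?thesis by auto
    qed
    show ?thesis
    proof (cases "v \<in> ?W")
      case True
      show ?thesis by (rule bexI[OF _ W]) (intro conjI dS dT True)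
    next
      case False
      have "?W \<noteq> {}" using V_D(3)[OF T] n_ge by auto
      have "\<exists>w\<in>?W. \<forall>y\<in>?W. nx y = v \<longrightarrow> y = w"
      proof (cases "\<exists>y\<in>?W. nx y = v")
        case True
        then show ?thesis using V_D(1)[OF W] nx_inj by metis
      next
        case False
        then show ?thesis using \<open>?W \<noteq> {}\<close> by auto
      qed
      then obtain w where w: "w \<in> ?W" "\<And>y. y \<in> ?W \<Longrightarrow> nx y = v \<Longrightarrow> y = w" by blast
      have "nx v \<notin> ?W" using nx_mem_image[OF T assms(2)] v by auto
      then have "insert v (?W - {w}) \<in> V"
        by (intro V_swap W w assms(2) False) auto
      moreover have "S \<inter> insert v (?W - {w}) = {}" "T \<inter> insert v (?W - {w}) = {}"
        using dS dT v by auto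
      ultimately show ?thesis by (intro bexI[of _ "insert v (?W - {w})"]) simp_all
    qed
  qed
  show ?thesis
  proof (cases "x \<in> S")
    case True
    then show ?thesis using *[OF assms(1) _ _ assms(3,4)] lab_cases[OF assms(1)] by auto
  next
    case False
    then have "x \<in> T" "nx x \<in> S" using lab_cases[OF assms(1)] by auto
    then show ?thesis using *[of T S] assms lab_sym by blast
  qed
qed

text \<open>If \<open>S\<close> and \<open>T\<close> are not related by a move, every
  \<open>a\<close> in \<open>S - T\<close> has both cycle neighbours in \<open>T\<close>: otherwise
  exchanging it into \<open>T\<close> yields a third set or a move. Then the symmetric difference is
  closed under \<open>nx\<close>, so \<open>S \<union> T\<close> is the whole cycle, which has more
  than \<open>2 * n\<close> points.\<close>

lemma only_two_imp_moved:
  assumes S: "S \<in> V" and T: "T \<in> V" and "S \<noteq> T"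
    and only: "\<And>U. U \<in> V \<Longrightarrow> U \<subseteq> S \<union> T \<Longrightarrow> U = S \<or> U = T"
  shows "moved S T"
proof (rule ccontr)
  assume nm: "\<not> moved S T"
  have both: "nx a \<in> T \<and> (\<exists>b\<in>T. nx b = a)" if a: "a \<in> S - T" for a
  proof (rule ccontr)
    assume one: "\<not> ?thesis"
    have am: "a < m" using a V_D(1)[OF S] by auto
    consider (none) "nx a \<notin> T" "\<not> (\<exists>b\<in>T. nx b = a)" | (succ) "nx a \<in> T" "\<not> (\<exists>b\<in>T. nx b = a)"
      | (pred) b where "nx a \<notin> T" "b \<in> T" "nx b = a"
      using one by blast
    then show False
    proof cases
      case none
      \<comment> \<open>With no neighbour of \<open>a\<close> in \<open>T\<close>, any element of
        \<open>T\<close> may be exchanged for \<open>a\<close>; two different choices cannot both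
        give \<open>S\<close>.\<close>
      have "card T \<ge> 2" using V_D(3)[OF T] n_ge by simp
      then obtain t1 t2 where t: "t1 \<in> T" "t2 \<in> T" "t1 \<noteq> t2"
        by (metis card_le_Suc0_iff_eq V_D(4)[OF T] not_less_eq_eq numeral_2_eq_2)
      have "insert a (T - {t}) = S" if t: "t \<in> T" for t
      proof -
        have "insert a (T - {t}) \<in> V"
          by (rule V_swap) (use T t am a none in auto)
        moreover have "insert a (T - {t}) \<noteq> T" using a by auto
        ultimately show ?thesis using only a by blast
      qed
      from this[OF t(1)] this[OF t(2)] show False using t a by auto
    next
      case succ
      then have l: "lab T (insert a (T - {nx a})) a"
        using lab_backward[OF T am] by blast
      moreover have "insert a (T - {nx a}) \<noteq> T" using a by auto
      ultimately have "insert a (T - {nx a}) = S" using only labD(2)[OF l] a succ by blast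
      then show False using l nm lab_sym unfolding moved_def by auto
    next
      case pred
      have l: "lab T (insert (nx b) (T - {b})) b"
        by (rule lab_forward) (use T pred in auto)
      moreover have "insert a (T - {b}) \<noteq> T" using a by auto
      ultimately have "insert a (T - {b}) = S" using only labD(2)[OF l] a pred by blast
      then show False using l nm lab_sym pred unfolding moved_def by auto
    qed
  qed
  let ?A = "S - T" and ?B = "T - S"
  have fin: "finite ?A" "finite ?B" using S T V_D(4) by auto
  have "card ?A = card ?B"
    using V_D(3,4)[OF S] V_D(3,4)[OF T] by (metis card_Diff_subset_Int finite_Int Int_commute)
  have inj: "inj_on nx S" "inj_on nx T" using V_D(1)[OF S] V_D(1)[OF T] nx_inj by (auto simp: inj_on_def)
  have "nx ` ?A \<subseteq> ?B" using both V_D(2)[OF S] by auto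
  moreover have "card (nx ` ?A) = card ?A" by (rule card_image) (use inj in \<open>auto intro: inj_on_subset\<close>)
  ultimately have 1: "nx ` ?A = ?B" using fin \<open>card ?A = card ?B\<close> by (simp add: card_subset_eq)
  have "?A \<subseteq> nx ` ?B"
  proof
    fix a assume a: "a \<in> ?A"
    then obtain b where "b \<in> T" "nx b = a" using both by blast
    then show "a \<in> nx ` ?B" using a V_D(2)[OF S, of b] by auto
  qed
  moreover have "card (nx ` ?B) = card ?B" by (rule card_image) (use inj in \<open>auto intro: inj_on_subset\<close>)
  ultimately have 2: "?A = nx ` ?B" using fin \<open>card ?A = card ?B\<close> by (simp add: card_subset_eq)
  have closed: "nx y \<in> ?A \<union> ?B" if "y \<in> ?A \<union> ?B" for y
    using that 1 2 by blast
  have "\<not> S \<subseteq> T" using V_subset_eq[OF S T] assms(3) by auto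
  then obtain a where a: "a \<in> ?A" by auto
  have "y \<in> ?A \<union> ?B" if "y < m" for y
    by (rule cyc_induct[of "\<lambda>y. y \<in> ?A \<union> ?B" a]) (use a V_D(1)[OF S] closed that in blast)+
  then have "{..<m} \<subseteq> S \<union> T" by auto
  then have "m \<le> card (S \<union> T)"
    using card_mono[of "S \<union> T" "{..<m}"] V_D(4)[OF S] V_D(4)[OF T] by simp
  also have "\<dots> \<le> 2 * n" using card_Un_le[of S T] V_D(3)[OF S] V_D(3)[OF T] by simp
  finally show False using m_ge by simp
qed

text \<open>The right-hand side mentions only adjacency, so automorphisms preserve \<open>moved\<close>.\<close>

lemma moved_iff:
  assumes S: "S \<in> V" and T: "T \<in> V"
  shows "moved S T \<longleftrightarrow> S \<noteq> T \<and>
    (\<forall>U\<in>V. (\<forall>W\<in>V. SG_adj S W \<and> SG_adj T W \<longrightarrow> SG_adj U W) \<longrightarrow> U = S \<or> U = T)"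
proof
  assume "moved S T"
  then obtain x where l: "lab S T x" by (auto simp: moved_def)
  have "U = S \<or> U = T" if U: "U \<in> V" "\<forall>W\<in>V. SG_adj S W \<and> SG_adj T W \<longrightarrow> SG_adj U W" for U
  proof -
    have sub: "v \<in> S \<or> v \<in> T" if v: "v \<in> U" for v
      using ex_V_disjoint_through[OF l V_D(1)[OF U(1) v]] U(2) v by (auto simp: SG_adj_def)
    \<comment> \<open>\<open>S\<close> and \<open>T\<close> agree off the edge, and \<open>U\<close>
      contains at most one of its ends, so \<open>U\<close> lies inside one of them.\<close>
    consider "x \<notin> U" | "nx x \<notin> U" using V_D(2)[OF U(1)] by auto
    then have "U \<subseteq> S \<or> U \<subseteq> T"
    proof cases
      case 1
      then show ?thesis using sub labD(4)[OF l] lab_cases[OF l] by (smt (verit) subsetI)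
    next
      case 2
      then show ?thesis using sub labD(4)[OF l] lab_cases[OF l] by (smt (verit) subsetI)
    qed
    then show ?thesis using V_subset_eq U(1) S T by blast
  qed
  then show "S \<noteq> T \<and> (\<forall>U\<in>V. (\<forall>W\<in>V. SG_adj S W \<and> SG_adj T W \<longrightarrow> SG_adj U W) \<longrightarrow> U = S \<or> U = T)"
    using lab_neq[OF l] by blast
next
  assume r: "S \<noteq> T \<and> (\<forall>U\<in>V. (\<forall>W\<in>V. SG_adj S W \<and> SG_adj T W \<longrightarrow> SG_adj U W) \<longrightarrow> U = S \<or> U = T)"
  have "U = S \<or> U = T" if "U \<in> V" "U \<subseteq> S \<union> T" for U
    using r that unfolding SG_adj_def by blast
  then show "moved S T" using only_two_imp_moved[OF S T] r by blast
qed

lemma aut_moved: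
  assumes g: "SG_aut n k \<gamma>" and "moved S T"
  shows "moved (\<gamma> S) (\<gamma> T)"
proof -
  have S: "S \<in> V" and T: "T \<in> V" using assms(2) labD(1,2) by (auto simp: moved_def)
  have r: "S \<noteq> T" "\<And>U. U \<in> V \<Longrightarrow> (\<And>W. W \<in> V \<Longrightarrow> SG_adj S W \<Longrightarrow> SG_adj T W \<Longrightarrow> SG_adj U W) \<Longrightarrow> U = S \<or> U = T"
    using moved_iff[OF S T] assms(2) by blast+
  have "U' = \<gamma> S \<or> U' = \<gamma> T"
    if U': "U' \<in> V" "\<forall>W\<in>V. SG_adj (\<gamma> S) W \<and> SG_adj (\<gamma> T) W \<longrightarrow> SG_adj U' W" for U'
  proof -
    obtain U where U: "U \<in> V" "\<gamma> U = U'" using SG_autD(4)[OF g U'(1)] by blast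
    have "SG_adj U W" if "W \<in> V" "SG_adj S W" "SG_adj T W" for W
      using U' U that SG_autD(1,2)[OF g] S T by blast
    then show ?thesis using r(2)[OF U(1)] U(2) by blast
  qed
  then show ?thesis
    using moved_iff[OF SG_autD(1)[OF g S] SG_autD(1)[OF g T]] SG_autD(3)[OF g S T] r(1) by blast
qed

end

section \<open>Squares of moves and their labels\<close>

text \<open>Such a set is an initial segment of its residue class. This identifies the configuration
  in which no element can be pushed down.\<close>

lemma even_chain_eq:
  fixes R :: "nat set"
  assumes "finite R" "\<And>r. r \<in> R \<Longrightarrow> r mod 2 = p" "\<And>r. r \<in> R \<Longrightarrow> 2 \<le> r \<Longrightarrow> r - 2 \<in> R"
  shows "R = (\<lambda>i. 2 * i + p) ` {..<card R}"
proof -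
  let ?f = "\<lambda>i. 2 * i + p"
  have inj: "inj_on ?f A" for A by (auto simp: inj_on_def)
  have ex: "\<exists>i. ?f i \<notin> R"
  proof (rule ccontr)
    assume "\<not> ?thesis"
    then have "range ?f \<subseteq> R" by auto
    then have "finite (range ?f)" using assms(1) finite_subset by blast
    then show False using finite_imageD[OF _ inj[of UNIV]] by simp
  qed
  define N where "N = (LEAST i. ?f i \<notin> R)"
  have N: "?f N \<notin> R" using LeastI_ex[OF ex] by (simp add: N_def)
  have below: "?f i \<in> R" if "i < N" for i using not_less_Least[of i] that by (auto simp: N_def)
  have above: "?f (N + j) \<notin> R" for j
  proof (induction j)
    case (Suc j)
    then show ?case using assms(3)[of "?f (N + Suc j)"] by auto
  qed (use N in simp)
  have "R = ?f ` {..<N}"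
  proof
    show "R \<subseteq> ?f ` {..<N}"
    proof
      fix r assume r: "r \<in> R"
      have e: "r = ?f (r div 2)" using assms(2)[OF r] by presburger
      have "r div 2 < N"
        using above[of "r div 2 - N"] r e by (metis le_add_diff_inverse not_less)
      then show "r \<in> ?f ` {..<N}" using e by blast
    qed
  qed (use below in auto)
  moreover from this have "card R = N" by (metis card_image card_lessThan inj)
  ultimately show ?thesis by simp
qed

context stable_kneser
begin

lemma nx_iter_neq:
  assumes "x < m"
  shows "nx x \<noteq> x" "nx (nx x) \<noteq> x" "nx (nx (nx x)) \<noteq> x" "nx (nx (nx (nx x))) \<noteq> x"
    "nx (nx (nx (nx (nx x)))) \<noteq> x" "nx (nx (nx (nx (nx (nx x))))) \<noteq> x"
  using assms m_ge(1) by (auto simp: nx_def)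

text \<open>Seven consecutive points are distinct because \<open>m \<ge> 7\<close>.\<close>

lemma chain_distinct:
  assumes "q < m"
  shows "distinct [q, nx q, nx (nx q), nx (nx (nx q)), nx (nx (nx (nx q))),
    nx (nx (nx (nx (nx q)))), nx (nx (nx (nx (nx (nx q)))))]"
  using assms nx_iter_neq[of q] by (auto simp: nx_less nx_inj dest: sym)

text \<open>
  Four edges of a cycle of length at least 5 can only sum to zero modulo 2 if they cancel
  in pairs.
\<close>

lemma four_edges_cancel:
  assumes lt: "x < m" "y < m" "z < m" "w < m" and ne: "x \<noteq> y" "x \<noteq> z"
    and par: "\<And>p. (p = x \<or> p = nx x) = (((p = y \<or> p = nx y) = (p = z \<or> p = nx z)) = (p = w \<or> p = nx w))"
  shows "x = w"
proof (rule ccontr)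
  assume xw: "x \<noteq> w"
  obtain x1 where x1: "x1 < m" "nx x1 = x" using nx_surj lt(1) by blast
  obtain q where q: "q < m" "nx q = x1" using nx_surj x1(1) by blast
  have d: "distinct [q, x1, x, nx x, nx (nx x)]" using chain_distinct[OF q(1)] q x1 by simp
  have lt': "nx x < m" "nx (nx x) < m" using nx_less lt by auto
  \<comment> \<open>This turns \<open>u = nx v\<close> into an equation between labels. Parity at
    \<open>x\<close>, \<open>nx x\<close> and the two points next to this edge then becomes a finite
    problem about equalities.\<close>
  have e: "(u = nx v) = (v = u1)" if "u1 < m" "nx u1 = u" "v < m" for u u1 v
    using nx_inj that by metis
  note e1 = e[OF q(1,2)] and e2 = e[OF x1] and e3 = e[OF lt(1) refl] and e4 = e[OF lt'(1) refl]
  note E = e1[OF lt(1)] e1[OF lt(2)] e1[OF lt(3)] e1[OF lt(4)]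
    e2[OF lt(1)] e2[OF lt(2)] e2[OF lt(3)] e2[OF lt(4)]
    e3[OF lt(1)] e3[OF lt(2)] e3[OF lt(3)] e3[OF lt(4)]
    e4[OF lt(1)] e4[OF lt(2)] e4[OF lt(3)] e4[OF lt(4)]
  have p1: "((x = y \<or> y = x1) = (x = z \<or> z = x1)) = (x = w \<or> w = x1)"
    using par[of x] unfolding E by simp
  have p2: "((nx x = y \<or> y = x) = (nx x = z \<or> z = x)) = (nx x = w \<or> w = x)"
    using par[of "nx x"] unfolding E by simp
  have p3: "((x1 = y \<or> y = q) = (x1 = z \<or> z = q)) \<noteq> (x1 = w \<or> w = q)"
    using par[of x1] d unfolding E by auto
  have p4: "((nx (nx x) = y \<or> y = nx x) = (nx (nx x) = z \<or> z = nx x)) \<noteq> (nx (nx x) = w \<or> w = nx x)"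
  proof -
    have "nx (nx x) \<noteq> x" "nx (nx x) \<noteq> nx x" using d by auto
    then show ?thesis using par[of "nx (nx x)"] unfolding E(13-16) by blast
  qed
  have "distinct [q, x1, x, t, u] \<Longrightarrow> ((x = y \<or> y = x1) = (x = z \<or> z = x1)) = (x = w \<or> w = x1) \<Longrightarrow>
    ((t = y \<or> y = x) = (t = z \<or> z = x)) = (t = w \<or> w = x) \<Longrightarrow>
    ((x1 = y \<or> y = q) = (x1 = z \<or> z = q)) \<noteq> (x1 = w \<or> w = q) \<Longrightarrow>
    ((u = y \<or> y = t) = (u = z \<or> z = t)) \<noteq> (u = w \<or> w = t) \<Longrightarrow> False" for t u
    using ne xw by (smt (verit) distinct_length_2_or_more)
  from this[OF d p1 p2 p3 p4] show False .
qed

text \<open>Going round \<open>T\<close>, \<open>A\<close>, \<open>U\<close>, \<open>B\<close>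
  toggles each point an even number of times, so the four labels cancel in pairs. Labels at a common
  corner differ because \<open>A \<noteq> B\<close> and \<open>U \<noteq> T\<close>, so opposite
  sides carry equal labels.\<close>

lemma square:
  assumes "lab T A x" "lab T B y" "moved A U" "moved B U" "U \<noteq> T" "A \<noteq> B"
  shows "lab A U y" "lab B U x"
proof -
  obtain z w where zw: "lab A U z" "lab B U w" using assms(3,4) by (auto simp: moved_def)
  have lt: "x < m" "y < m" "z < m" "w < m" using labD(3) assms(1,2) zw by auto
  have "x \<noteq> y" using lab_target_unique assms(1,2,6) by blast
  moreover have "x \<noteq> z" using lab_target_unique[of A T x U] assms(1,5) zw(1) lab_sym by blast
  moreover have par: "(p = x \<or> p = nx x) = (((p = y \<or> p = nx y) = (p = z \<or> p = nx z)) = (p = w \<or> p = nx w))" for p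
    using labD(4)[OF assms(1), of p] labD(4)[OF assms(2), of p] labD(4)[OF zw(1), of p] labD(4)[OF zw(2), of p]
    by blast
  ultimately have w: "x = w" using four_edges_cancel[OF lt] by blast
  then have "{y, nx y} = {z, nx z}" using par by auto
  then have "y = z" using nx_neq lt by (metis doubleton_eq_iff)
  then show "lab A U y" "lab B U x" using w zw by auto
qed

text \<open>The last hypothesis names the image edge without fixing its orientation, so that
  reflections are covered as well.\<close>

lemma lab_image:
  assumes d: "SG_aut n k ((`) d)" "inj_on d {..<m}"
    and "S \<in> V" "T \<in> V" "x < m" "y < m" "{y, nx y} = {d x, d (nx x)}"
  shows "lab (d ` S) (d ` T) y \<longleftrightarrow> lab S T x"
proof -
  have sub: "S \<subseteq> {..<m}" "T \<subseteq> {..<m}" "(S - T) \<union> (T - S) \<subseteq> {..<m}" "{x, nx x} \<subseteq> {..<m}"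
    using assms V_D(1) nx_less by auto
  have "(d ` S - d ` T) \<union> (d ` T - d ` S) = d ` ((S - T) \<union> (T - S))"
    using sub(1,2) d(2) by (simp add: image_Un inj_on_image_set_diff[OF d(2)] Diff_subset[THEN subset_trans])
  moreover have "{y, nx y} = d ` {x, nx x}" using assms by simp
  moreover have "d ` ((S - T) \<union> (T - S)) = d ` {x, nx x} \<longleftrightarrow> (S - T) \<union> (T - S) = {x, nx x}"
    by (rule inj_on_image_eq_iff[OF d(2) sub(3,4)])
  ultimately show ?thesis
    unfolding lab_def using assms(3-6) SG_autD(1)[OF d(1)] by simp
qed

lemma lab_nx:
  "S \<in> V \<Longrightarrow> T \<in> V \<Longrightarrow> x < m \<Longrightarrow> lab (nx ` S) (nx ` T) (nx x) \<longleftrightarrow> lab S T x"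
  by (rule lab_image[OF aut_nx]) (auto simp: inj_on_def nx_inj nx_less)

text \<open>
  For a fixed label, here the edge between \<open>m - 2\<close> and \<open>m - 1\<close>, pushing the remaining elements down
  one at a time gives a chain of squares to a standard move.
\<close>

lemma aut_label_last:
  assumes g: "SG_aut n k \<gamma>"
    and "lab S T (m - 2)" "m - 2 \<in> S"
    and R0: "R0 = (\<lambda>i. 2 * i + 1) ` {..<n - 1}"
  shows "lab (insert (m - 2) R0) (insert (m - 1) R0) (m - 2) \<and>
    (\<forall>z. lab (\<gamma> (insert (m - 2) R0)) (\<gamma> (insert (m - 1) R0)) z \<longrightarrow> lab (\<gamma> S) (\<gamma> T) z)"
  using assms(2,3)
proof (induction "\<Sum>S" arbitrary: S T rule: less_induct)
  case less
  note l = less.prems(1)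
  note S = labD(1)[OF l] and T = labD(2)[OF l]
  have nxm: "nx (m - 2) = m - 1" "nx (m - 1) = 0" using m_ge by (auto simp: nx_def)
  define R where "R = S - {m - 2}"
  have mem: "m - 1 \<notin> S" "m - 2 \<notin> T" "m - 1 \<in> T" using lab_cases[OF l] less.prems(2) nxm by auto
  have TR: "T = insert (m - 1) R" "S = insert (m - 2) R" "m - 1 \<notin> R" "m - 2 \<notin> R"
    using mem less.prems(2) labD(4)[OF l] unfolding nxm R_def by auto
  have finR: "finite R" using V_D(4)[OF S] by (simp add: R_def)
  show ?case
  proof (cases "\<exists>r\<in>R. 2 \<le> r \<and> r - 2 \<notin> R")
    case True
    \<comment> \<open>As \<open>r - 2\<close> is free, \<open>r\<close> can be pushed to
      \<open>r - 1\<close> in \<open>S\<close> and \<open>T\<close> at once. The two moves and the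
      two pushes form a square, and the sum of the elements drops.\<close>
    then obtain r where r: "r \<in> R" "2 \<le> r" "r - 2 \<notin> R" by blast
    have rm: "r < m" "r \<noteq> m - 1" "r \<noteq> m - 2" using r TR V_D(1)[OF S] by auto
    define b where "b = r - 1"
    have b: "nx b = r" "b < m" "b \<noteq> m - 1" "b \<noteq> m - 2" "Suc b = r" using rm r by (auto simp: b_def nx_def)
    have pred: "z = r - 2" if "nx z = b" for z
      using that r by (auto simp: b_def nx_def split: if_splits)
    have pS: "nx z \<noteq> b" if "z \<in> S" for z using pred[of z] that r TR rm by auto
    have pT: "nx z \<noteq> b" if "z \<in> T" for z using pred[of z] that r TR rm by auto
    have rS: "nx b \<in> S" and rT: "nx b \<in> T" using b r TR by auto
    define S' where "S' = insert b (S - {r})"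
    define T' where "T' = insert b (T - {r})"
    have lS: "lab S S' b" using lab_backward[OF S b(2) rS pS] b by (simp add: S'_def)
    have lT: "lab T T' b" using lab_backward[OF T b(2) rT pT] b by (simp add: T'_def)
    have "(S' - T') \<union> (T' - S') = {m - 2, m - 1}"
      using b rm TR(3,4) unfolding S'_def T'_def TR(1,2) by auto
    then have l': "lab S' T' (m - 2)" using labD(2)[OF lS] labD(2)[OF lT] nxm m_ge by (simp add: lab_def)
    have in': "m - 2 \<in> S'" using rm less.prems(2) by (simp add: S'_def)
    have "b \<notin> S" using V_D(2)[OF S, of b] rS by auto
    then have "\<Sum>S' = b + \<Sum>(S - {r})" using V_D(4)[OF S] by (simp add: S'_def)
    moreover have "\<Sum>S = r + \<Sum>(S - {r})"
      using rS b V_D(4)[OF S] by (simp add: sum.remove)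
    ultimately have "\<Sum>S' < \<Sum>S" using b by simp
    from less.hyps[OF this l' in'] have IH:
      "lab (insert (m - 2) R0) (insert (m - 1) R0) (m - 2)"
      "\<And>z. lab (\<gamma> (insert (m - 2) R0)) (\<gamma> (insert (m - 1) R0)) z \<Longrightarrow> lab (\<gamma> S') (\<gamma> T') z"
      by blast+
    have "lab (\<gamma> S) (\<gamma> T) z" if z: "lab (\<gamma> S') (\<gamma> T') z" for z
    proof -
      obtain c where c: "lab (\<gamma> S') (\<gamma> S) c"
        using aut_moved[OF g] lS lab_sym by (metis moved_def)
      have m1: "moved (\<gamma> T') (\<gamma> T)" "moved (\<gamma> S) (\<gamma> T)"
        using aut_moved[OF g] lT l lab_sym by (metis moved_def)+
      have "T \<noteq> S'" "T' \<noteq> S" using mem b rm by (auto simp: S'_def T'_def)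
      then have "\<gamma> T \<noteq> \<gamma> S'" "\<gamma> T' \<noteq> \<gamma> S"
        using SG_autD(3)[OF g] S T labD(2)[OF lS] labD(2)[OF lT] by auto
      then show ?thesis using square(2)[OF z c m1] by blast
    qed
    then show ?thesis using IH by blast
  next
    case False
    \<comment> \<open>Nothing can be pushed: \<open>R\<close> is closed under subtracting two. It
      misses \<open>0\<close>, a neighbour of \<open>m - 1 \<in> T\<close>, so it consists of odd
      numbers.\<close>
    have odd: "r mod 2 = 1" if "r \<in> R" for r
      using that
    proof (induction r rule: less_induct)
      case (less r)
      have "0 \<notin> R" using V_D(2)[OF T, of "m - 1"] nxm TR(1) by auto
      then have "r \<noteq> 0" using less.prems by metis
      show ?case
      proof (cases "2 \<le> r")
        case True
        then have "r - 2 \<in> R" using False less.prems by blast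
        then show ?thesis using less.IH[of "r - 2"] True by presburger
      next
        case False
        then show ?thesis using \<open>r \<noteq> 0\<close> by presburger
      qed
    qed
    have "card R = n - 1" using V_D(3,4)[OF S] less.prems(2) by (simp add: R_def)
    then have "R = R0" using even_chain_eq[OF finR odd] False R0 by auto
    then show ?thesis using l TR(1,2) by simp
  qed
qed

text \<open>The label \<open>nx y\<close> for \<open>\<gamma>\<close> is the label \<open>y\<close>
  for \<open>\<gamma>\<close> after rotation, so the claim is generalised over
  \<open>\<gamma>\<close> before going round the cycle.\<close>

lemma aut_label_ex:
  assumes "SG_aut n k \<gamma>" "x < m"
  shows "\<exists>z. \<forall>S T. lab S T x \<longrightarrow> lab (\<gamma> S) (\<gamma> T) z"
proof -
  have "\<forall>\<gamma>. SG_aut n k \<gamma> \<longrightarrow> (\<exists>z. \<forall>S T. lab S T x \<longrightarrow> lab (\<gamma> S) (\<gamma> T) z)"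
  proof (rule cyc_induct[OF _ _ _ assms(2)])
    show "m - 2 < m" using m_ge by simp
    show "\<forall>\<gamma>. SG_aut n k \<gamma> \<longrightarrow> (\<exists>z. \<forall>S T. lab S T (m - 2) \<longrightarrow> lab (\<gamma> S) (\<gamma> T) z)"
    proof (intro allI impI)
      fix \<gamma> assume g: "SG_aut n k \<gamma>"
      define R0 where "R0 = (\<lambda>i. 2 * i + 1) ` {..<n - 1}"
      note * = aut_label_last[OF g _ _ R0_def]
      show "\<exists>z. \<forall>S T. lab S T (m - 2) \<longrightarrow> lab (\<gamma> S) (\<gamma> T) z"
      proof (cases "lab (insert (m - 2) R0) (insert (m - 1) R0) (m - 2)")
        case True
        then obtain z where z: "lab (\<gamma> (insert (m - 2) R0)) (\<gamma> (insert (m - 1) R0)) z"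
          using aut_moved[OF g] by (metis moved_def)
        have "lab (\<gamma> S) (\<gamma> T) z" if l: "lab S T (m - 2)" for S T
        proof (cases "m - 2 \<in> S")
          case True
          then show ?thesis using *[OF l] z by blast
        next
          case False
          then have "m - 2 \<in> T" using lab_cases[OF l] by auto
          then show ?thesis using *[of T S] l lab_sym z by blast
        qed
        then show ?thesis by blast
      next
        case False
        have "\<not> lab S T (m - 2)" for S T
        proof
          assume l: "lab S T (m - 2)"
          then have "m - 2 \<in> S \<or> m - 2 \<in> T" using lab_cases by auto
          then show False using *[OF l] *[of T S] l lab_sym False by blast
        qed
        then show ?thesis by blast
      qed
    qed
  next
    fix y assume y: "y < m" and IH: "\<forall>\<gamma>. SG_aut n k \<gamma> \<longrightarrow> (\<exists>z. \<forall>S T. lab S T y \<longrightarrow> lab (\<gamma> S) (\<gamma> T) z)"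
    show "\<forall>\<gamma>. SG_aut n k \<gamma> \<longrightarrow> (\<exists>z. \<forall>S T. lab S T (nx y) \<longrightarrow> lab (\<gamma> S) (\<gamma> T) z)"
    proof (intro allI impI)
      fix \<gamma> assume g: "SG_aut n k \<gamma>"
      from IH SG_aut_comp[OF g aut_nx] obtain z
        where z: "\<And>S T. lab S T y \<Longrightarrow> lab (\<gamma> (nx ` S)) (\<gamma> (nx ` T)) z" by blast
      have "lab (\<gamma> S) (\<gamma> T) z" if l: "lab S T (nx y)" for S T
      proof -
        obtain S' T' where "S' \<in> V" "nx ` S' = S" "T' \<in> V" "nx ` T' = T"
          using SG_autD(4)[OF aut_nx] labD(1,2)[OF l] by metis
        then show ?thesis using z[of S' T'] lab_nx[of S' T' y] y l by simp
      qed
      then show "\<exists>z. \<forall>S T. lab S T (nx y) \<longrightarrow> lab (\<gamma> S) (\<gamma> T) z" by blast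
    qed
  qed
  then show ?thesis using assms(1) by blast
qed

definition label_map :: "(nat set \<Rightarrow> nat set) \<Rightarrow> (nat \<Rightarrow> nat) \<Rightarrow> bool" where
  "label_map \<gamma> g \<longleftrightarrow> (\<forall>S T x. lab S T x \<longrightarrow> lab (\<gamma> S) (\<gamma> T) (g x))"

lemma label_map_ex:
  assumes "SG_aut n k \<gamma>"
  obtains g where "label_map \<gamma> g"
proof -
  have "\<forall>x. \<exists>z. \<forall>S T. lab S T x \<longrightarrow> lab (\<gamma> S) (\<gamma> T) z"
    using aut_label_ex[OF assms] labD(3) by blast
  then have "\<exists>g. \<forall>x. \<forall>S T. lab S T x \<longrightarrow> lab (\<gamma> S) (\<gamma> T) (g x)"
    by (rule choice)
  then obtain g where "\<forall>x. \<forall>S T. lab S T x \<longrightarrow> lab (\<gamma> S) (\<gamma> T) (g x)" by blast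
  then have "label_map \<gamma> g" unfolding label_map_def by blast
  then show thesis by (rule that)
qed

lemma label_map_nx: "label_map ((`) nx) nx"
  using lab_nx labD(1-3) by (auto simp: label_map_def)

end

section \<open>The action on the edges of the cycle\<close>

context stable_kneser
begin

lemma aut_inv:
  assumes "SG_aut n k \<gamma>"
  shows "SG_aut n k (inv_into V \<gamma>)" "S \<in> V \<Longrightarrow> inv_into V \<gamma> (\<gamma> S) = S" "S \<in> V \<Longrightarrow> \<gamma> (inv_into V \<gamma> S) = S"
proof -
  have b: "bij_betw \<gamma> V V" using assms by (simp add: SG_aut_def)
  show 1: "\<And>S. S \<in> V \<Longrightarrow> inv_into V \<gamma> (\<gamma> S) = S"
    using b by (simp add: bij_betw_inv_into_left)
  show 2: "\<And>S. S \<in> V \<Longrightarrow> \<gamma> (inv_into V \<gamma> S) = S"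
    using b by (simp add: bij_betw_inv_into_right)
  have b': "bij_betw (inv_into V \<gamma>) V V" using b by (rule bij_betw_inv_into)
  have "SG_adj S T \<longleftrightarrow> SG_adj (inv_into V \<gamma> S) (inv_into V \<gamma> T)" if "S \<in> V" "T \<in> V" for S T
    using SG_autD(2)[OF assms, of "inv_into V \<gamma> S" "inv_into V \<gamma> T"] 2 that bij_betw_apply[OF b'] by simp
  then show "SG_aut n k (inv_into V \<gamma>)" using b' by (simp add: SG_aut_def)
qed

lemma aut_moved_iff:
  assumes "SG_aut n k \<gamma>" "S \<in> V" "T \<in> V"
  shows "moved (\<gamma> S) (\<gamma> T) \<longleftrightarrow> moved S T"
  using aut_moved[OF assms(1), of S T] aut_moved[OF aut_inv(1)[OF assms(1)], of "\<gamma> S" "\<gamma> T"]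
  unfolding aut_inv(2)[OF assms(1,2)] aut_inv(2)[OF assms(1,3)] by blast

text \<open>Two moves out of \<open>T\<close> that do not complete to a square. The non-existence
  part speaks only of \<open>moved\<close>, hence is preserved by automorphisms; on labels, a clash
  will mean distance one or two.\<close>

definition clash :: "nat \<Rightarrow> nat \<Rightarrow> bool" where
  "clash x y \<longleftrightarrow> (\<exists>T A B. lab T A x \<and> lab T B y \<and> A \<noteq> B \<and>
     \<not> (\<exists>U. U \<noteq> T \<and> moved A U \<and> moved B U))"

lemma clash_sym: "clash x y \<longleftrightarrow> clash y x"
proof -
  have "clash y x" if c: "clash x y" for x y
  proof -
    obtain T A B where "lab T A x" "lab T B y" "A \<noteq> B" "\<not> (\<exists>U. U \<noteq> T \<and> moved A U \<and> moved B U)"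
      using c unfolding clash_def by (elim exE conjE)
    then show ?thesis unfolding clash_def
      by (intro exI[of _ T] exI[of _ B] exI[of _ A]) metis
  qed
  then show ?thesis by blast
qed

lemma clash_less: "clash x y \<Longrightarrow> x < m \<and> y < m"
  unfolding clash_def using labD(3) by blast

lemma moved_V: "moved S T \<Longrightarrow> S \<in> V \<and> T \<in> V"
  unfolding moved_def using labD(1,2) by blast

lemma label_map_clash:
  assumes g: "SG_aut n k \<gamma>" and l: "label_map \<gamma> g" and "clash x y"
  shows "clash (g x) (g y)"
proof -
  obtain T A B where TAB: "lab T A x" "lab T B y" "A \<noteq> B"
    "\<not> (\<exists>U. U \<noteq> T \<and> moved A U \<and> moved B U)"
    using assms(3) unfolding clash_def by blast
  have V: "T \<in> V" "A \<in> V" "B \<in> V" using labD(1,2) TAB by auto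
  have "lab (\<gamma> T) (\<gamma> A) (g x)" "lab (\<gamma> T) (\<gamma> B) (g y)" using l TAB by (auto simp: label_map_def)
  moreover have "\<gamma> A \<noteq> \<gamma> B" using SG_autD(3)[OF g V(2,3)] TAB(3) by simp
  moreover have "\<not> (\<exists>U. U \<noteq> \<gamma> T \<and> moved (\<gamma> A) U \<and> moved (\<gamma> B) U)"
  proof
    assume "\<exists>U. U \<noteq> \<gamma> T \<and> moved (\<gamma> A) U \<and> moved (\<gamma> B) U"
    then obtain U where U: "U \<noteq> \<gamma> T" "moved (\<gamma> A) U" "moved (\<gamma> B) U" by blast
    then obtain U' where U': "U' \<in> V" "\<gamma> U' = U" using SG_autD(4)[OF g] moved_V by blast
    then have "moved A U'" "moved B U'" "U' \<noteq> T"
      using aut_moved_iff[OF g _ U'(1)] V U by auto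
    then show False using TAB(4) by blast
  qed
  ultimately show ?thesis unfolding clash_def by blast
qed

text \<open>The last point is \<open>2 * n + a - 4\<close>; the bounds keep it at most
  \<open>m - 1\<close>, and at most \<open>m - 2\<close> when \<open>s = 0\<close>.\<close>

lemma ladder_V:
  assumes "a \<ge> 3" "2 * n + a \<le> m + 3" "S = insert s ((\<lambda>i. 2 * i + a) ` {..<n - 1})" "s + 2 \<le> a"
    "s = 0 \<longrightarrow> 2 * n + a \<le> m + 2"
  shows "S \<in> V"
proof -
  have lt: "2 * i + a + 1 < m + (if s = 0 then 0 else 1)" if "i < n - 1" for i
    using that assms(2,5) by auto
  have "inj_on (\<lambda>i. 2 * i + a) {..<n - 1}" by (auto simp: inj_on_def)
  then have "card ((\<lambda>i. 2 * i + a) ` {..<n - 1}) = n - 1" by (simp add: card_image)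
  moreover have "s \<notin> (\<lambda>i. 2 * i + a) ` {..<n - 1}" using assms(4) by auto
  ultimately have "card S = n" using n_ge assms(3) by simp
  moreover have "x < m" if "x \<in> S" for x
    using that lt assms(3,4) assms(1,2) n_ge by (fastforce split: if_splits)
  moreover have "nx x \<notin> S" if x: "x \<in> S" for x
  proof
    assume a: "nx x \<in> S"
    have step: "nx x = (if x + 1 = m then 0 else x + 1)" by (simp add: nx_def)
    consider "x = s" | i where "i < n - 1" "x = 2 * i + a" using x unfolding assms(3) by blast
    then show False
    proof cases
      case 1
      then show False using a step assms(1-4) n_ge by (auto split: if_splits)
    next
      case (2 i)
      show False
      proof (cases "x + 1 = m")
        case True
        then have "s = 0" using a step assms(3,1) by auto
        then show False using lt[OF 2(1)] 2 True by simp
      next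
        case False
        then have "2 * i + a + 1 \<in> S" using a step 2 by simp
        then show False using assms(3,4) by auto presburger
      qed
    qed
  qed
  ultimately show ?thesis by (auto simp: V_iff)
qed

text \<open>In \<open>{2, 5, 7, ...}\<close> both moves displace the element \<open>2\<close>. After
  it has gone to \<open>1\<close>, no move along the edge from \<open>2\<close> to \<open>3\<close>
  is possible.\<close>

lemma clash_1_2: "clash 1 2"
proof -
  let ?R = "(\<lambda>i. 2 * i + 5) ` {..<n - 1}"
  define T where "T = insert 2 ?R"
  have T: "T \<in> V" by (rule ladder_V[of 5 T 2]) (use m_ge in \<open>auto simp: T_def\<close>)
  have nx: "nx 1 = 2" "nx 2 = 3" "nx 3 = 4" using m_ge by (auto simp: nx_def)
  have l1: "lab T (insert 1 (T - {2})) 1"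
  proof -
    have "nx z \<noteq> 1" if "z \<in> T" for z
      using that by (auto simp: T_def nx_def split: if_splits)
    then show ?thesis using lab_backward[OF T, of 1] nx m_ge by (simp add: T_def)
  qed
  have l2: "lab T (insert 3 (T - {2})) 2"
  proof -
    have "2 \<in> T" "4 \<notin> T" by (auto simp: T_def)
    then show ?thesis using lab_forward[OF T, of 2] nx by simp
  qed
  have "1 \<notin> insert 3 (T - {2})" by (auto simp: T_def)
  then have ne: "insert 1 (T - {2}) \<noteq> insert 3 (T - {2})" by blast
  have "\<not> (\<exists>U. U \<noteq> T \<and> moved (insert 1 (T - {2})) U \<and> moved (insert 3 (T - {2})) U)"
  proof
    assume "\<exists>U. U \<noteq> T \<and> moved (insert 1 (T - {2})) U \<and> moved (insert 3 (T - {2})) U"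
    then obtain U where U: "U \<noteq> T" "moved (insert 1 (T - {2})) U" "moved (insert 3 (T - {2})) U" by blast
    from square(1)[OF l1 l2 U(2,3,1) ne] have "lab (insert 1 (T - {2})) U 2" .
    from lab_cases[OF this] show False using nx by (auto simp: T_def)
  qed
  then show ?thesis using l1 l2 ne unfolding clash_def by blast
qed

text \<open>In \<open>{0, 3, 5, ...}\<close> performing both moves would put \<open>1\<close> and
  \<open>2\<close> into one stable set.\<close>

lemma clash_0_2: "clash 0 2"
proof -
  let ?R = "(\<lambda>i. 2 * i + 3) ` {..<n - 1}"
  define T where "T = insert 0 ?R"
  have T: "T \<in> V" by (rule ladder_V[of 3 T 0]) (use m_ge in \<open>auto simp: T_def\<close>)
  have nx: "nx 0 = 1" "nx 1 = 2" "nx 2 = 3" using m_ge by (auto simp: nx_def)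
  have "0 < n - 1" using n_ge by simp
  then have in3: "3 \<in> T" by (force simp: T_def)
  have out: "1 \<notin> T" "2 \<notin> T" "0 \<in> T" by (auto simp: T_def)
  let ?A = "insert 1 (T - {0})" and ?B = "insert 2 (T - {3})"
  have l1: "lab T ?A 0"
    using lab_forward[OF T, of 0] nx out by auto
  have l2: "lab T ?B 2"
  proof -
    have pred: "nx z \<noteq> 2" if "z \<in> T" for z
    proof
      assume "nx z = 2"
      then have "z = 1" by (simp add: nx_def split: if_splits)
      then show False using that out by simp
    qed
    have "2 < m" "nx 2 \<in> T" using m_ge in3 nx by simp_all
    from lab_backward[OF T this pred] show ?thesis unfolding nx .
  qed
  have "1 \<in> ?A" "1 \<notin> ?B" using out by simp_all
  then have ne: "?A \<noteq> ?B" by metis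
  have "\<not> (\<exists>U. U \<noteq> T \<and> moved ?A U \<and> moved ?B U)"
  proof
    assume "\<exists>U. U \<noteq> T \<and> moved ?A U \<and> moved ?B U"
    then obtain U where U: "U \<noteq> T" "moved ?A U" "moved ?B U" by blast
    from square(2)[OF l1 l2 U(2,3,1) ne] have l: "lab ?B U 0" .
    have "0 \<in> ?B" using out by simp
    then have "nx 0 \<in> U" using lab_cases[OF l] by blast
    moreover have "2 \<in> U" using labD(4)[OF l, of 2] nx(1) by simp
    ultimately show False using V_D(2)[OF labD(2)[OF l], of 1] nx(1,2) by simp
  qed
  then show ?thesis using l1 l2 ne unfolding clash_def by blast
qed

lemma clash_nx:
  assumes "x < m"
  shows "clash x (nx x)" "clash x (nx (nx x))"
proof -
  have s: "nx 0 = 1" "nx 1 = 2" using m_ge by (auto simp: nx_def)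
  note step = label_map_clash[OF aut_nx label_map_nx]
  show "clash x (nx x)"
    by (rule cyc_induct[of "\<lambda>x. clash x (nx x)" 1]) (use s clash_1_2 m_ge step assms in auto)
  show "clash x (nx (nx x))"
    by (rule cyc_induct[of "\<lambda>x. clash x (nx (nx x))" 0]) (use s clash_0_2 m_ge step assms in auto)
qed

text \<open>Edges further apart have no common or neighbouring ends, so the two moves are
  independent and performing both gives the fourth corner of a square.\<close>

lemma clash_imp_close:
  assumes "clash x y"
  shows "y = nx x \<or> y = nx (nx x) \<or> x = nx y \<or> x = nx (nx y)"
proof (rule ccontr)
  assume far: "\<not> ?thesis"
  obtain T A B where TAB: "lab T A x" "lab T B y" "A \<noteq> B"
    and none: "\<not> (\<exists>U. U \<noteq> T \<and> moved A U \<and> moved B U)"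
    using assms unfolding clash_def by blast
  have xy: "x < m" "y < m" "x \<noteq> y" using labD(3) TAB lab_target_unique by blast+
  have V: "T \<in> V" "A \<in> V" "B \<in> V" using labD(1,2) TAB by auto
  have disj: "x \<noteq> nx y" "nx x \<noteq> y" "nx x \<noteq> nx y" using far xy nx_inj by auto
  note mA = labD(4)[OF TAB(1)] and mB = labD(4)[OF TAB(2)]
  have "\<exists>U. lab A U y"
  proof (cases "y \<in> T")
    case True
    then have "nx y \<in> B" using lab_cases[OF TAB(2)] by auto
    then have "nx (nx y) \<notin> B" using V_D(2)[OF V(3)] by auto
    then have "nx (nx y) \<notin> T" using mB nx_neq xy nx_less by metis
    moreover have "nx (nx y) \<noteq> x" "nx (nx y) \<noteq> nx x" using far xy nx_inj nx_less by auto
    ultimately have "nx (nx y) \<notin> A" using mA by auto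
    moreover have "y \<in> A" using mA True disj xy by auto
    ultimately show ?thesis using lab_forward[OF V(2)] by blast
  next
    case False
    then have yT: "nx y \<in> T" "y \<in> B" using lab_cases[OF TAB(2)] by auto
    have "nx z \<noteq> y" if z: "z \<in> A" for z
    proof
      assume e: "nx z = y"
      then have "z \<notin> B" using yT V_D(2)[OF V(3)] by auto
      moreover have "z \<noteq> y" "z \<noteq> nx y" using e nx_neq[OF xy(2)] by metis+
      ultimately have "z \<notin> T" using mB by auto
      then have "z = x \<or> z = nx x" using z mA by auto
      then show False using e far by auto
    qed
    moreover have "nx y \<in> A" using mA yT disj by auto
    ultimately show ?thesis using lab_backward[OF V(2) xy(2)] by blast
  qed
  then obtain U where U: "lab A U y" by blast
  note mU = labD(4)[OF U]
  have "(B - U) \<union> (U - B) = {x, nx x}"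
    using mA mB mU disj xy(3) by (auto simp: set_eq_iff)
  then have "lab B U x" using V(3) labD(2)[OF U] xy by (simp add: lab_def)
  moreover have "U \<noteq> T" using mU[of x] mA[of x] disj xy by auto
  ultimately show False using none U unfolding moved_def by blast
qed

text \<open>Singles out distance one: \<open>x\<close> and \<open>nx x\<close> have common clash
  partners on both sides, while labels at distance two share only the midpoint, since
  \<open>m \<ge> 7\<close>.\<close>

definition clash2 :: "nat \<Rightarrow> nat \<Rightarrow> bool" where
  "clash2 x y \<longleftrightarrow> clash x y \<and> (\<exists>u v. u \<noteq> v \<and> clash u x \<and> clash u y \<and> clash v x \<and> clash v y)"

lemma clash2_nx:
  assumes "x < m"
  shows "clash2 x (nx x)"
proof -
  obtain u where u: "u < m" "nx u = x" using nx_surj assms by blast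
  have "clash u x" "clash u (nx x)" using clash_nx[OF u(1)] u(2) by auto
  moreover have "clash (nx (nx x)) x" "clash (nx (nx x)) (nx x)"
    using clash_nx assms nx_less clash_sym by blast+
  moreover have "u \<noteq> nx (nx x)" using nx_iter_neq(3)[OF u(1)] u(2) by auto
  ultimately show ?thesis using clash_nx(1)[OF assms] unfolding clash2_def by blast
qed

lemma clash2_imp_adjacent:
  assumes "clash2 x y"
  shows "y = nx x \<or> x = nx y"
proof -
  have no: False if c: "clash2 x (nx (nx x))" for x
  proof -
    have xm: "x < m" using c clash_less by (auto simp: clash2_def)
    obtain x1 where x1: "x1 < m" "nx x1 = x" using nx_surj xm by blast
    obtain q where q: "q < m" "nx q = x1" using nx_surj x1(1) by blast
    note d = chain_distinct[OF q(1), unfolded q(2) x1(2)]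
    have "p = nx x" if p: "clash p x" "clash p (nx (nx x))" for p
    proof -
      have pm: "p < m" using p clash_less by blast
      have lt: "nx x < m" "nx (nx x) < m" "nx p < m" using nx_less xm pm by auto
      have "p = nx x \<or> p = nx (nx x) \<or> p = x1 \<or> p = q"
        using clash_imp_close[OF p(1)] nx_inj[OF pm x1(1)] nx_inj[OF lt(3) x1(1)] nx_inj[OF pm q(1)] x1(2) q(2)
        by auto
      moreover have "p = nx (nx (nx x)) \<or> p = nx (nx (nx (nx x))) \<or> p = nx x \<or> p = x"
        using clash_imp_close[OF p(2)] nx_inj[OF pm lt(1)] nx_inj[OF lt(3) lt(1)] nx_inj[OF pm xm]
        by auto
      ultimately show ?thesis using d by auto
    qed
    then show False using c unfolding clash2_def by metis
  qed
  have "clash x y" "clash2 y x" using assms clash_sym unfolding clash2_def by blast+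
  then show ?thesis using clash_imp_close[of x y] no assms by blast
qed

lemma label_map_less:
  assumes "label_map \<gamma> g" "x < m"
  shows "g x < m"
proof -
  obtain T A where "lab T A x" using clash_nx(1)[OF assms(2)] unfolding clash_def by blast
  then have "lab (\<gamma> T) (\<gamma> A) (g x)" using assms(1) by (simp add: label_map_def)
  then show ?thesis by (rule labD(3))
qed

lemma label_map_inj:
  assumes "SG_aut n k \<gamma>" "label_map \<gamma> g"
  shows "inj_on g {..<m}"
proof -
  obtain h where h: "label_map (inv_into V \<gamma>) h" using label_map_ex[OF aut_inv(1)[OF assms(1)]] .
  have "h (g x) = x" if x: "x < m" for x
  proof -
    obtain T A where l: "lab T A x" using clash_nx(1)[OF x] unfolding clash_def by blast
    then have "lab (\<gamma> T) (\<gamma> A) (g x)" using assms(2) unfolding label_map_def by blast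
    then have "lab (inv_into V \<gamma> (\<gamma> T)) (inv_into V \<gamma> (\<gamma> A)) (h (g x))"
      using h unfolding label_map_def by blast
    then have "lab T A (h (g x))"
      unfolding aut_inv(2)[OF assms(1) labD(1)[OF l]] aut_inv(2)[OF assms(1) labD(2)[OF l]] .
    from lab_unique[OF this l] show ?thesis .
  qed
  then show ?thesis by (intro inj_on_inverseI[of _ h]) simp
qed

text \<open>\<open>g\<close> sends neighbouring edges to neighbouring edges, and injectivity forbids
  turning back, so its direction is constant around the cycle.\<close>

lemma label_map_dihedral:
  assumes "SG_aut n k \<gamma>" "label_map \<gamma> g"
  shows "(\<forall>x<m. g (nx x) = nx (g x)) \<or> (\<forall>x<m. nx (g (nx x)) = g x)"
proof -
  have adj: "g (nx x) = nx (g x) \<or> g x = nx (g (nx x))" if x: "x < m" for x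
  proof -
    note c = label_map_clash[OF assms]
    obtain u v where uv: "u \<noteq> v" "clash u x" "clash u (nx x)" "clash v x" "clash v (nx x)"
      using clash2_nx[OF x] unfolding clash2_def by blast
    have "g u \<noteq> g v"
      using inj_onD[OF label_map_inj[OF assms], of u v] uv clash_less by blast
    then have "clash2 (g x) (g (nx x))"
      using c uv clash_nx(1)[OF x] unfolding clash2_def by blast
    then show ?thesis by (rule clash2_imp_adjacent)
  qed
  have keep: "g (nx x) = nx (g x) \<longleftrightarrow> g (nx (nx x)) = nx (g (nx x))" if x: "x < m" for x
  proof -
    have lt: "nx x < m" "nx (nx x) < m" using nx_less x by auto
    have gl: "g x < m" "g (nx x) < m" "g (nx (nx x)) < m"
      using label_map_less[OF assms(2)] x lt by auto
    have "g (nx (nx x)) \<noteq> g x"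
      using inj_onD[OF label_map_inj[OF assms], of "nx (nx x)" x] x lt nx_iter_neq(2)[OF x] by auto
    then show ?thesis using adj[OF x] adj[OF lt(1)] nx_inj gl nx_iter_neq(2) by metis
  qed
  have all: "(g (nx x) = nx (g x)) = (g (nx 0) = nx (g 0))" if "x < m" for x
    by (rule cyc_induct[of "\<lambda>x. (g (nx x) = nx (g x)) = (g (nx 0) = nx (g 0))" 0])
      (use keep m_ge that in auto)
  then show ?thesis using adj by metis
qed

end

section \<open>Automorphisms preserve the component of the canonical colouring\<close>

context stable_kneser
begin

text \<open>The reflected edge runs backwards, so it starts at the image of
  \<open>nx x\<close>.\<close>

lemma label_map_reflect: "label_map ((`) reflect) (\<lambda>x. reflect (nx x))"
  unfolding label_map_def
proof (intro allI impI)
  fix S T x assume l: "lab S T x"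
  have x: "x < m" using labD(3)[OF l] .
  have "{reflect (nx x), nx (reflect (nx x))} = {reflect x, reflect (nx x)}"
    using nx_reflect[OF x] by auto
  from lab_image[OF aut_reflect reflect_inj labD(1)[OF l] labD(2)[OF l] x reflect_less[OF nx_less[OF x]] this] l
  show "lab (reflect ` S) (reflect ` T) (reflect (nx x))" by simp
qed

lemma label_map_comp:
  "label_map \<delta> h \<Longrightarrow> label_map \<gamma> g \<Longrightarrow> label_map (\<lambda>S. \<delta> (\<gamma> S)) (\<lambda>x. h (g x))"
  unfolding label_map_def by blast

text \<open>The end point of descent: every other stable \<open>n\<close>-set admits a move that
  lowers the sum of its elements.\<close>

definition M0 :: "nat set" where "M0 = (\<lambda>i. 2 * i) ` {..<n}"

text \<open>Inside a run of spacing two nothing can move; only the first element can step back and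
  the last one forward.\<close>

lemma lab_M0_cases:
  assumes l: "lab M0 W x"
  shows "x = m - 1 \<or> x = 2 * n - 2"
proof -
  have x: "x < m" and mem: "\<And>p. p \<in> W \<longleftrightarrow> (p \<in> M0 \<longleftrightarrow> p \<noteq> x \<and> p \<noteq> nx x)"
    using labD(3,4)[OF l] by blast+
  have W: "W \<in> V" using labD(2)[OF l] .
  from lab_cases[OF l] show ?thesis
  proof
    assume a: "x \<in> M0 \<and> nx x \<notin> M0 \<and> x \<notin> W \<and> nx x \<in> W"
    then obtain i where i: "i < n" "x = 2 * i" by (auto simp: M0_def)
    have "i = n - 1"
    proof (rule ccontr)
      assume "i \<noteq> n - 1"
      then have "Suc i < n" using i by simp
      then have y: "2 * Suc i \<in> M0" unfolding M0_def by blast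
      have nx: "nx x = 2 * i + 1" "nx (nx x) = 2 * Suc i" using i m_ge \<open>Suc i < n\<close> by (auto simp: nx_def)
      then have "nx (nx x) \<in> W" using mem[of "nx (nx x)"] y i by simp
      then show False using V_D(2)[OF W] a by blast
    qed
    then show ?thesis using i n_ge by arith
  next
    assume a: "x \<notin> M0 \<and> nx x \<in> M0 \<and> x \<in> W \<and> nx x \<notin> W"
    then obtain i where i: "i < n" "nx x = 2 * i" by (auto simp: M0_def)
    have "i = 0"
    proof (rule ccontr)
      assume "i \<noteq> 0"
      then obtain j where j: "i = Suc j" using not0_implies_Suc by blast
      have xe: "x = 2 * j + 1" using i j by (simp add: nx_def split: if_splits)
      have "2 * j \<in> M0" using i j by (auto simp: M0_def)
      then have "2 * j \<in> W" using mem[of "2 * j"] i j xe by simp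
      moreover have "nx (2 * j) = x" using xe x by (simp add: nx_def)
      ultimately show False using V_D(2)[OF W] a by blast
    qed
    then have "x + 1 = m" using i by (simp add: nx_def split: if_splits)
    then show ?thesis by linarith
  qed
qed

text \<open>The image admits the same labels as \<open>M0\<close>. If it missed \<open>0\<close>,
  the label \<open>m - 1\<close> would force \<open>m - 1\<close> into it, and blocked backward
  moves would propagate down in steps of two to \<open>0\<close>. From \<open>0\<close>, blocked
  forward moves then force \<open>2, 4, ...\<close> up to \<open>2 * n - 2\<close>.\<close>

lemma M0_fixed:
  assumes g: "SG_aut n k \<gamma>" "label_map \<gamma> g" and id: "\<And>x. x < m \<Longrightarrow> g x = x" and M0: "M0 \<in> V"
  shows "\<gamma> M0 = M0"
proof -
  let ?U = "\<gamma> M0"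
  have U: "?U \<in> V" using SG_autD(1)[OF g(1) M0] .
  have labels: "x = m - 1 \<or> x = 2 * n - 2" if l: "lab ?U W x" for W x
  proof -
    obtain W' where W': "W' \<in> V" "\<gamma> W' = W" using SG_autD(4)[OF g(1) labD(2)[OF l]] by blast
    have "moved ?U (\<gamma> W')" using l W'(2) unfolding moved_def by blast
    then obtain y where y: "lab M0 W' y" using aut_moved_iff[OF g(1) M0 W'(1)] unfolding moved_def by blast
    then have "lab ?U W (g y)" using g(2) W'(2) unfolding label_map_def by blast
    then have "x = y" using lab_unique[OF l] id[OF labD(3)[OF y]] by simp
    then show ?thesis using lab_M0_cases[OF y] by simp
  qed
  have m0: "nx (m - 1) = 0" using m_ge by (simp add: nx_def)
  have "0 \<in> ?U"
  proof (rule ccontr)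
    assume no: "0 \<notin> ?U"
    have "lab M0 (insert (m - 1) (M0 - {nx (m - 1)})) (m - 1)"
    proof (rule lab_backward[OF M0])
      show "m - 1 < m" using m_ge by simp
      show "nx (m - 1) \<in> M0" using m0 n_ge by (force simp: M0_def)
      show "nx z \<noteq> m - 1" if "z \<in> M0" for z
        using that m_ge by (auto simp: M0_def nx_def)
    qed
    then have "lab ?U (\<gamma> (insert (m - 1) (M0 - {nx (m - 1)}))) (g (m - 1))"
      using g(2) unfolding label_map_def by blast
    then have "lab ?U (\<gamma> (insert (m - 1) (M0 - {nx (m - 1)}))) (m - 1)" using id m_ge by simp
    then have last: "m - 1 \<in> ?U" using lab_cases m0 no by metis
    have down: "m - 1 - 2 * j \<in> ?U" if "2 * j \<le> m - 1" for j
      using that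
    proof (induction j)
      case (Suc j)
      define u where "u = m - 1 - 2 * j"
      have u: "u \<in> ?U" "2 \<le> u" "even u" "u < m" using Suc odd_m m_ge by (auto simp: u_def)
      have "u - 2 \<in> ?U"
      proof (rule ccontr)
        assume not2: "u - 2 \<notin> ?U"
        have "lab ?U (insert (u - 1) (?U - {nx (u - 1)})) (u - 1)"
        proof (rule lab_backward[OF U])
          show "u - 1 < m" "nx (u - 1) \<in> ?U" using u by (auto simp: nx_def)
          show "nx z \<noteq> u - 1" if "z \<in> ?U" for z
          proof
            assume "nx z = u - 1"
            then have "z = u - 2" using u by (auto simp: nx_def split: if_splits)
            then show False using not2 that by simp
          qed
        qed
        \<comment> \<open>\<open>u\<close> is even, so the label \<open>u - 1\<close> is odd, and it
          is below \<open>m - 1\<close>.\<close>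
        from labels[OF this] have "u - 1 = 2 * n - 2" using u by auto
        then show False using u by presburger
      qed
      moreover have "m - 1 - 2 * Suc j = u - 2" by (simp add: u_def)
      ultimately show ?case by simp
    qed (use last in simp)
    have "even (m - 1)" using odd_m by simp
    then have "2 * ((m - 1) div 2) = m - 1" by simp
    then show False using down[of "(m - 1) div 2"] no by simp
  qed
  have "2 * i \<in> ?U" if "i < n" for i
    using that
  proof (induction i)
    case (Suc i)
    have nx: "nx (nx (2 * i)) = 2 * Suc i" using Suc.prems m_ge by (simp add: nx_def)
    show ?case
    proof (rule ccontr)
      assume "2 * Suc i \<notin> ?U"
      then have "lab ?U (insert (nx (2 * i)) (?U - {2 * i})) (2 * i)"
        using lab_forward[OF U, of "2 * i"] Suc nx by simp
      from labels[OF this] show False using Suc.prems m_ge by auto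
    qed
  qed (use \<open>0 \<in> ?U\<close> in simp)
  then have "M0 \<subseteq> ?U" by (auto simp: M0_def)
  then show ?thesis using V_subset_eq M0 U by metis
qed

text \<open>If no element can step back, \<open>S\<close> is closed under subtracting two. Starting
  at \<open>0\<close> this gives \<open>M0\<close>; starting at \<open>1\<close> it makes all
  elements odd, contradicting the parity of \<open>m\<close>.\<close>

lemma decrease:
  assumes S: "S \<in> V" "S \<noteq> M0"
  obtains S' b where "lab S S' b" "\<Sum>S' < \<Sum>S"
proof -
  note result = that
  have card: "card S = n" "finite S" using V_D(3,4)[OF S(1)] by auto
  have "\<exists>r\<in>S. 1 \<le> r \<and> (\<forall>z\<in>S. nx z \<noteq> r - 1)"
  proof (rule ccontr)
    assume "\<not> ?thesis"
    then have st: "\<exists>z\<in>S. nx z = r - 1" if "r \<in> S" "1 \<le> r" for r using that by blast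
    have down: "r - 2 \<in> S" if r: "r \<in> S" "2 \<le> r" for r
    proof -
      obtain z where z: "z \<in> S" "nx z = r - 1" using st[of r] r by auto
      then have "z = r - 2" using r by (auto simp: nx_def split: if_splits)
      then show ?thesis using z by simp
    qed
    show False
    proof (cases "1 \<in> S")
      case True
      then have no0: "0 \<notin> S" using V_D(2)[OF S(1), of 0] m_ge by (auto simp: nx_def)
      have odd: "r mod 2 = 1" if "r \<in> S" for r
        using that
      proof (induction r rule: less_induct)
        case (less r)
        show ?case
        proof (cases "2 \<le> r")
          case True
          then have "(r - 2) mod 2 = 1" using less.IH[of "r - 2"] down[OF less.prems] by simp
          then show ?thesis using True by presburger
        next
          case False
          then have "r = 0 \<or> r = 1" by auto
          then show ?thesis using no0 less.prems by auto
        qed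
      qed
      \<comment> \<open>Only \<open>m - 1\<close> can block the step from \<open>1\<close> to
        \<open>0\<close>, but it is even since \<open>m\<close> is odd.\<close>
      obtain z where z: "z \<in> S" "nx z = 0" using st[OF True] by auto
      then have "z = m - 1" by (auto simp: nx_def split: if_splits)
      then have "(m - 1) mod 2 = 1" using odd z(1) by blast
      then show False using odd_m by presburger
    next
      case False
      have "r mod 2 = 0" if "r \<in> S" for r
        using that
      proof (induction r rule: less_induct)
        case (less r)
        show ?case
        proof (cases "2 \<le> r")
          case True
          then have "(r - 2) mod 2 = 0" using less.IH[of "r - 2"] down[OF less.prems] by simp
          then show ?thesis using True by presburger
        next
          case f: False
          then have "r = 0 \<or> r = 1" by auto
          then show ?thesis using False less.prems by auto
        qed
      qed
      from even_chain_eq[OF card(2) this down] have "S = M0" using card(1) by (simp add: M0_def)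
      then show False using S(2) by simp
    qed
  qed
  then obtain r where r: "r \<in> S" "1 \<le> r" "\<And>z. z \<in> S \<Longrightarrow> nx z \<noteq> r - 1" by blast
  have rm: "r < m" using V_D(1)[OF S(1) r(1)] .
  have nxr: "nx (r - 1) = r" using r(2) rm by (simp add: nx_def)
  have l: "lab S (insert (r - 1) (S - {r})) (r - 1)"
    using lab_backward[OF S(1) _ _ r(3)] nxr r(1) rm by simp
  have notin: "r - 1 \<notin> S" using V_D(2)[OF S(1), of "r - 1"] nxr r(1) by auto
  have "\<Sum>(insert (r - 1) (S - {r})) = (r - 1) + \<Sum>(S - {r})" using card(2) notin by simp
  moreover have "\<Sum>S = r + \<Sum>(S - {r})" using r(1) card(2) by (simp add: sum.remove)
  ultimately have "\<Sum>(insert (r - 1) (S - {r})) < \<Sum>S" using r(2) by simp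
  with l show thesis by (rule result)
qed

text \<open>Descent to \<open>M0\<close>: once \<open>S'\<close> is fixed, \<open>S\<close> and its
  image arise from \<open>S'\<close> by a move with the same label and hence coincide.\<close>

lemma label_id_imp_id:
  assumes g: "SG_aut n k \<gamma>" "label_map \<gamma> g" and id: "\<And>x. x < m \<Longrightarrow> g x = x" and "S \<in> V"
  shows "\<gamma> S = S"
  using assms(4)
proof (induction "\<Sum>S" arbitrary: S rule: less_induct)
  case less
  show ?case
  proof (cases "S = M0")
    case True
    then show ?thesis using M0_fixed[OF g id] less.prems by simp
  next
    case False
    obtain S' b where S': "lab S S' b" "\<Sum>S' < \<Sum>S" using decrease[OF less.prems False] .
    have "\<gamma> S' = S'" using less.hyps[OF S'(2) labD(2)[OF S'(1)]] .
    moreover have "lab (\<gamma> S) (\<gamma> S') (g b)" using g(2) S'(1) unfolding label_map_def by blast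
    ultimately have "lab S' (\<gamma> S) b" using id[OF labD(3)[OF S'(1)]] lab_sym by simp
    moreover have "lab S' S b" using S'(1) lab_sym by simp
    ultimately show ?thesis by (rule lab_target_unique)
  qed
qed

text \<open>The measure counts the rotations needed to bring \<open>g 0\<close> back to
  \<open>0\<close>; each is cancelled in turn. Once \<open>g 0 = 0\<close>, \<open>g\<close> fixes
  every label and \<open>\<gamma>\<close> is the identity on \<open>V\<close>.\<close>

lemma preserves_component_if_commutes:
  assumes "SG_aut n k \<gamma>" "label_map \<gamma> g" "\<forall>x<m. g (nx x) = nx (g x)"
  shows "preserves_component \<gamma>"
  using assms
proof (induction "if g 0 = 0 then 0 else m - g 0" arbitrary: \<gamma> g rule: less_induct)
  case less
  show ?case
  proof (cases "g 0 = 0")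
    case True
    have "g x = x" if "x < m" for x
      by (rule cyc_induct[of "\<lambda>x. g x = x" 0]) (use True less.prems(3) that m_ge in auto)
    then have "\<gamma> S = S" if "S \<in> V" for S using label_id_imp_id[OF less.prems(1,2)] that by blast
    then have "(\<lambda>S\<in>V. col (\<gamma> S)) = (\<lambda>S\<in>V. col S)" by (intro restrict_ext) simp
    then show ?thesis using hom_conn_refl[OF col_hom] col_restrict by (simp add: preserves_component_def)
  next
    case False
    have "g 0 < m" using label_map_less[OF less.prems(2)] m_ge by simp
    then have lt: "(if nx (g 0) = 0 then 0 else m - nx (g 0)) < (if g 0 = 0 then 0 else m - g 0)"
      using False by (auto simp: nx_def)
    have "preserves_component (\<lambda>S. nx ` \<gamma> S)"
    proof (rule less.hyps[of "\<lambda>x. nx (g x)"])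
      show "(if nx (g 0) = 0 then 0 else m - nx (g 0)) < (if g 0 = 0 then 0 else m - g 0)" by (rule lt)
      show "SG_aut n k (\<lambda>S. nx ` \<gamma> S)" by (rule SG_aut_comp[OF aut_nx less.prems(1)])
      show "label_map (\<lambda>S. nx ` \<gamma> S) (\<lambda>x. nx (g x))" by (rule label_map_comp[OF label_map_nx less.prems(2)])
      show "\<forall>x<m. nx (g (nx x)) = nx (nx (g x))" using less.prems(3) by simp
    qed
    then show ?thesis by (rule preserves_component_cancel[OF preserves_component_nx less.prems(1)])
  qed
qed

lemma aut_preserves_component:
  assumes g: "SG_aut n k \<gamma>" and k: "k mod 4 = 3"
  shows "preserves_component \<gamma>"
proof -
  obtain g where l: "label_map \<gamma> g" using label_map_ex[OF g] .
  from label_map_dihedral[OF g l] show ?thesis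
  proof
    assume "\<forall>x<m. g (nx x) = nx (g x)"
    then show ?thesis by (rule preserves_component_if_commutes[OF g l])
  next
    assume anti: "\<forall>x<m. nx (g (nx x)) = g x"
    \<comment> \<open>Composing with the reflection restores the orientation and leads back to the
      commuting case.\<close>
    have "preserves_component (\<lambda>S. reflect ` \<gamma> S)"
    proof (rule preserves_component_if_commutes[of _ "\<lambda>x. reflect (nx (g x))"])
      show "SG_aut n k (\<lambda>S. reflect ` \<gamma> S)" by (rule SG_aut_comp[OF aut_reflect g])
      show "label_map (\<lambda>S. reflect ` \<gamma> S) (\<lambda>x. reflect (nx (g x)))"
        by (rule label_map_comp[OF label_map_reflect l])
      show "\<forall>x<m. reflect (nx (g (nx x))) = nx (reflect (nx (g x)))"
      proof (intro allI impI)
        fix x assume x: "x < m"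
        have "g x < m" using label_map_less[OF l x] .
        then show "reflect (nx (g (nx x))) = nx (reflect (nx (g x)))"
          using anti x nx_reflect by simp
      qed
    qed
    then show ?thesis by (rule preserves_component_cancel[OF preserves_component_reflect[OF k] g])
  qed
qed

end

theorem theorem4p3:
  fixes n k :: nat and \<gamma> :: "nat set \<Rightarrow> nat set"
  assumes "k mod 4 = 3" and "n \<ge> 2" and "SG_aut n k \<gamma>"
  shows "hom_path n k (canon_col n k)
           (\<lambda>S\<in>SG_verts n k. canon_col n k (\<gamma> S))"
proof -
  have "k \<ge> 3" "odd k" using assms(1) by presburger+
  then interpret stable_kneser n k "2 * n + k"
    by unfold_locales (use assms(2) in auto)
  have "preserves_component \<gamma>" using aut_preserves_component[OF assms(3,1)] .
  then show ?thesis unfolding preserves_component_def by (rule hom_conn_imp_hom_path)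
qed

end
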